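(* There is a strict 2-category ${\tt Lei2Alg}$ of Leibniz 2-algebras, whose 1-morphisms are the Leibniz 2-algebra morphisms and whose 2-morphisms are the Leibniz 2-algebra 2-morphisms, with horizontal and vertical compositions of 2-morphisms those of natural transformations.
   Context: $\mathbb K$ is a field of characteristic $0$. A linear category is a category internal to $\mathbb K$-vector spaces (vector space $L_0$ of objects, vector space of morphisms, all structure maps linear); functors and natural transformations are required to be (multi)linear as indicated. **Leibniz 2-algebra** $(L,[-,-],\mathbf J)$: a linear category $L$ with a bilinear functor $[-,-]:L\times L\to L$ (bracket) and a trilinear natural transformation (Jacobiator) $\mathbf J_{x,y,z}:[x,[y,z]]\to[[x,y],z]+[y,[x,z]]$, such that for all $w,x,y,z\in L_0$ the following two composites from $[w,[x,[y,z]]]$ to $[[[w,x],y],z]+[[x,[w,y]],z]+[[x,y],[w,z]]+[[w,y],[x,z]]+[y,[[w,x],z]]+[y,[x,[w,z]]]$ coincide (arrows applied in the order listed, identities on remaining summands understood): (i) $[\mathbf 1_w,\mathbf J_{x,y,z}]$, then $\mathbf J_{w,[x,y],z}+\mathbf J_{w,y,[x,z]}$, then $\mathbf 1+[\mathbf 1_y,\mathbf J_{w,x,z}]$, then $[\mathbf J_{w,x,y},\mathbf 1_z]+\mathbf 1$; (ii) $\mathbf J_{w,x,[y,z]}$, then $\mathbf 1+[\mathbf 1_x,\mathbf J_{w,y,z}]$, then $\mathbf J_{[w,x],y,z}+\mathbf J_{x,[w,y],z}+\mathbf J_{x,y,[w,z]}$. **Leibniz 2-algebra morphism** $(F,\mathbf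 F):L\to L'$: a linear functor $F:L\to L'$ with a bilinear natural transformation $\mathbf F_{x,y}:[Fx,Fy]\to F[x,y]$ such that for all $x,y,z\in L_0$ the following composites $[Fx,[Fy,Fz]]\to F[[x,y],z]+F[y,[x,z]]$ coincide: (i) $\mathbf J_{Fx,Fy,Fz}$, then $[\mathbf F_{x,y},\mathbf 1_{Fz}]+[\mathbf 1_{Fy},\mathbf F_{x,z}]$, then $\mathbf F_{[x,y],z}+\mathbf F_{y,[x,z]}$; (ii) $[\mathbf 1_{Fx},\mathbf F_{y,z}]$, then $\mathbf F_{x,[y,z]}$, then $F\mathbf J_{x,y,z}$. Composition of $(F,\mathbf F):L\to L'$ and $(G,\mathbf G):L'\to L''$ is given by composition of functors and whiskering: the functor $GF$ with $[GFx,GFy]\xrightarrow{\mathbf G_{Fx,Fy}}G[Fx,Fy]\xrightarrow{G\mathbf F_{x,y}}GF[x,y]$. **Leibniz 2-algebra 2-morphism** $\boldsymbol\theta:(F,\mathbf F)\Rightarrow(G,\mathbf G)$, for $(F,\mathbf F),(G,\mathbf G):L\to L'$: a linear natural transformation $\boldsymbol\theta:F\Rightarrow G$ such that $\boldsymbol\theta_{[x,y]}\circ\mathbf F_{x,y}=\mathbf G_{x,y}\circ[\boldsymbol\theta_x,\boldsymbol\theta_y]$ for all $x,y\in L_0$. *)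

theory Defs
  imports "HOL-Algebra.Module" "HOL-Library.FuncSet"
begin

section \<open>Categories, functors and natural transformations\<close>

record ('o, 'm) cat =
  Obj :: "'o set"
  Arr :: "'m set"
  src :: "'m \<Rightarrow> 'o"
  tgt :: "'m \<Rightarrow> 'o"
  ident :: "'o \<Rightarrow> 'm"
  cmp :: "'m \<Rightarrow> 'm \<Rightarrow> 'm" (infixr "\<bullet>\<index>" 75)

text \<open>Composition is written in the classical order: \<open>g \<bullet> f\<close> is \<open>f\<close> followed by \<open>g\<close>, and it is
  meaningful only when \<open>tgt f = src g\<close>.\<close>

locale category =
  fixes C :: "('o, 'm, 'z) cat_scheme" (structure)
  assumes src_closed: "f \<in> Arr C \<Longrightarrow> src C f \<in> Obj C"
    and tgt_closed: "f \<in> Arr C \<Longrightarrow> tgt C f \<in> Obj C"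
    and ident_closed: "x \<in> Obj C \<Longrightarrow> ident C x \<in> Arr C"
    and src_ident: "x \<in> Obj C \<Longrightarrow> src C (ident C x) = x"
    and tgt_ident: "x \<in> Obj C \<Longrightarrow> tgt C (ident C x) = x"
    and cmp_closed: "\<lbrakk>f \<in> Arr C; g \<in> Arr C; tgt C f = src C g\<rbrakk> \<Longrightarrow> g \<bullet> f \<in> Arr C"
    and src_cmp: "\<lbrakk>f \<in> Arr C; g \<in> Arr C; tgt C f = src C g\<rbrakk> \<Longrightarrow> src C (g \<bullet> f) = src C f"
    and tgt_cmp: "\<lbrakk>f \<in> Arr C; g \<in> Arr C; tgt C f = src C g\<rbrakk> \<Longrightarrow> tgt C (g \<bullet> f) = tgt C g"
    and cmp_assoc:
      "\<lbrakk>f \<in> Arr C; g \<in> Arr C; h \<in> Arr C; tgt C f = src C g; tgt C g = src C h\<rbrakk>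
        \<Longrightarrow> (h \<bullet> g) \<bullet> f = h \<bullet> (g \<bullet> f)"
    and cmp_ident_right: "f \<in> Arr C \<Longrightarrow> f \<bullet> ident C (src C f) = f"
    and cmp_ident_left: "f \<in> Arr C \<Longrightarrow> ident C (tgt C f) \<bullet> f = f"

definition prod_cat ::
    "('o, 'm, 'y) cat_scheme \<Rightarrow> ('p, 'n, 'z) cat_scheme \<Rightarrow> ('o \<times> 'p, 'm \<times> 'n) cat"
  where "prod_cat C D =
    \<lparr> Obj = Obj C \<times> Obj D,
      Arr = Arr C \<times> Arr D,
      src = map_prod (src C) (src D),
      tgt = map_prod (tgt C) (tgt D),
      ident = map_prod (ident C) (ident D),
      cmp = (\<lambda>(g, g') (f, f'). (g \<bullet>\<^bsub>C\<^esub> f, g' \<bullet>\<^bsub>D\<^esub> f')) \<rparr>"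

record ('o, 'm, 'p, 'n) fctr =
  ob :: "'o \<Rightarrow> 'p"
  ar :: "'m \<Rightarrow> 'n"

locale cat_functor = C: category C + D: category D
  for C :: "('o, 'm, 'y) cat_scheme" and D :: "('p, 'n, 'z) cat_scheme" +
  fixes F :: "('o, 'm, 'p, 'n) fctr"
  assumes ob_closed: "x \<in> Obj C \<Longrightarrow> ob F x \<in> Obj D"
    and ar_closed: "f \<in> Arr C \<Longrightarrow> ar F f \<in> Arr D"
    and src_ar: "f \<in> Arr C \<Longrightarrow> src D (ar F f) = ob F (src C f)"
    and tgt_ar: "f \<in> Arr C \<Longrightarrow> tgt D (ar F f) = ob F (tgt C f)"
    and ar_ident: "x \<in> Obj C \<Longrightarrow> ar F (ident C x) = ident D (ob F x)"
    and ar_cmp: "\<lbrakk>f \<in> Arr C; g \<in> Arr C; tgt C f = src C g\<rbrakk>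
      \<Longrightarrow> ar F (g \<bullet>\<^bsub>C\<^esub> f) = ar F g \<bullet>\<^bsub>D\<^esub> ar F f"

locale nat_trans = F: cat_functor C D F + G: cat_functor C D G
  for C :: "('o, 'm, 'y) cat_scheme" and D :: "('p, 'n, 'z) cat_scheme"
    and F :: "('o, 'm, 'p, 'n) fctr" and G :: "('o, 'm, 'p, 'n) fctr" +
  fixes \<theta> :: "'o \<Rightarrow> 'n"
  assumes component_closed: "x \<in> Obj C \<Longrightarrow> \<theta> x \<in> Arr D"
    and src_component: "x \<in> Obj C \<Longrightarrow> src D (\<theta> x) = ob F x"
    and tgt_component: "x \<in> Obj C \<Longrightarrow> tgt D (\<theta> x) = ob G x"
    and naturality:
      "f \<in> Arr C \<Longrightarrow> \<theta> (tgt C f) \<bullet>\<^bsub>D\<^esub> ar F f = ar G f \<bullet>\<^bsub>D\<^esub> \<theta> (src C f)"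

definition id_functor :: "('o, 'm, 'o, 'm) fctr"
  where "id_functor = \<lparr> ob = (\<lambda>x. x), ar = (\<lambda>f. f) \<rparr>"

definition comp_functor ::
    "('p, 'n, 'q, 'l) fctr \<Rightarrow> ('o, 'm, 'p, 'n) fctr \<Rightarrow> ('o, 'm, 'q, 'l) fctr"
  where "comp_functor G F = \<lparr> ob = ob G \<circ> ob F, ar = ar G \<circ> ar F \<rparr>"

definition prod_functor ::
    "('o, 'm, 'p, 'n) fctr \<Rightarrow> ('o1, 'm1, 'p1, 'n1) fctr
      \<Rightarrow> ('o \<times> 'o1, 'm \<times> 'm1, 'p \<times> 'p1, 'n \<times> 'n1) fctr"
  where "prod_functor F G =
    \<lparr> ob = map_prod (ob F) (ob G), ar = map_prod (ar F) (ar G) \<rparr>"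

text \<open>Two functors on \<open>C\<close> are equal if they agree on \<open>Obj C\<close> and \<open>Arr C\<close>.  So that this becomes
  equality in HOL, functors and transformations that occur as cells are normalised to be
  \<open>undefined\<close> off these carriers.\<close>

definition restrict_functor ::
    "('o, 'm, 'z) cat_scheme \<Rightarrow> ('o, 'm, 'p, 'n) fctr \<Rightarrow> ('o, 'm, 'p, 'n) fctr"
  where "restrict_functor C F = \<lparr> ob = restrict (ob F) (Obj C), ar = restrict (ar F) (Arr C) \<rparr>"

definition extensional_functor :: "('o, 'm, 'z) cat_scheme \<Rightarrow> ('o, 'm, 'p, 'n) fctr \<Rightarrow> bool"
  where "extensional_functor C F \<longleftrightarrow>
    ob F \<in> extensional (Obj C) \<and> ar F \<in> extensional (Arr C)"

definition id_trans ::
    "('o, 'm, 'y) cat_scheme \<Rightarrow> ('p, 'n, 'z) cat_scheme \<Rightarrow> ('o, 'm, 'p, 'n) fctr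
      \<Rightarrow> 'o \<Rightarrow> 'n"
  where "id_trans C D F = (\<lambda>x\<in>Obj C. ident D (ob F x))"

definition vcomp_trans ::
    "('o, 'm, 'y) cat_scheme \<Rightarrow> ('p, 'n, 'z) cat_scheme \<Rightarrow> ('o \<Rightarrow> 'n) \<Rightarrow> ('o \<Rightarrow> 'n)
      \<Rightarrow> 'o \<Rightarrow> 'n"
  where "vcomp_trans C D \<eta> \<theta> = (\<lambda>x\<in>Obj C. \<eta> x \<bullet>\<^bsub>D\<^esub> \<theta> x)"

text \<open>For \<open>\<theta> : F \<Rightarrow> G\<close> between functors from \<open>C\<close> to \<open>D\<close> and \<open>\<eta> : F' \<Rightarrow> G'\<close> between functors from
  \<open>D\<close> to \<open>E\<close>, the horizontal composite from \<open>F' F\<close> to \<open>G' G\<close> depends, besides the components, on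
  \<open>F'\<close> and \<open>G\<close>.\<close>

definition hcomp_trans ::
    "('o, 'm, 'y) cat_scheme \<Rightarrow> ('q, 'l, 'z) cat_scheme \<Rightarrow> ('p, 'n, 'q, 'l) fctr
      \<Rightarrow> ('o, 'm, 'p, 'n) fctr \<Rightarrow> ('p \<Rightarrow> 'l) \<Rightarrow> ('o \<Rightarrow> 'n) \<Rightarrow> 'o \<Rightarrow> 'l"
  where "hcomp_trans C E F' G \<eta> \<theta> = (\<lambda>x\<in>Obj C. \<eta> (ob G x) \<bullet>\<^bsub>E\<^esub> ar F' (\<theta> x))"


section \<open>Strict 2-categories\<close>

text \<open>The inherited fields of \<open>two_cat\<close> are the 0-cells, the 1-cells and their composition.\<close>

record ('a, 'f, 't) two_cat = "('a, 'f) cat" +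
  Cell2 :: "'t set"
  src2 :: "'t \<Rightarrow> 'f"
  tgt2 :: "'t \<Rightarrow> 'f"
  ident2 :: "'f \<Rightarrow> 't"
  vcmp :: "'t \<Rightarrow> 't \<Rightarrow> 't"
  hcmp :: "'t \<Rightarrow> 't \<Rightarrow> 't"

definition vertical_cat :: "('a, 'f, 't, 'z) two_cat_scheme \<Rightarrow> ('f, 't) cat"
  where "vertical_cat C =
    \<lparr> Obj = Arr C, Arr = Cell2 C, src = src2 C, tgt = tgt2 C, ident = ident2 C, cmp = vcmp C \<rparr>"

definition horizontal_cat :: "('a, 'f, 't, 'z) two_cat_scheme \<Rightarrow> ('a, 't) cat"
  where "horizontal_cat C =
    \<lparr> Obj = Obj C, Arr = Cell2 C, src = (\<lambda>\<alpha>. src C (src2 C \<alpha>)), tgt = (\<lambda>\<alpha>. tgt C (tgt2 C \<alpha>)),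
      ident = (\<lambda>A. ident2 C (ident C A)), cmp = hcmp C \<rparr>"

text \<open>The last four axioms say that horizontal composition is a functor from the product of the
  hom-categories, on 1-cells given by \<open>cmp\<close>.\<close>

locale strict_2_category =
  one: category C + vert: category "vertical_cat C" + horiz: category "horizontal_cat C"
  for C :: "('a, 'f, 't, 'z) two_cat_scheme" +
  assumes parallel_src: "\<alpha> \<in> Cell2 C \<Longrightarrow> src C (src2 C \<alpha>) = src C (tgt2 C \<alpha>)"
    and parallel_tgt: "\<alpha> \<in> Cell2 C \<Longrightarrow> tgt C (src2 C \<alpha>) = tgt C (tgt2 C \<alpha>)"
    and src2_hcmp:
      "\<lbrakk>\<alpha> \<in> Cell2 C; \<beta> \<in> Cell2 C; tgt C (tgt2 C \<alpha>) = src C (src2 C \<beta>)\<rbrakk>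
        \<Longrightarrow> src2 C (hcmp C \<beta> \<alpha>) = src2 C \<beta> \<bullet>\<^bsub>C\<^esub> src2 C \<alpha>"
    and tgt2_hcmp:
      "\<lbrakk>\<alpha> \<in> Cell2 C; \<beta> \<in> Cell2 C; tgt C (tgt2 C \<alpha>) = src C (src2 C \<beta>)\<rbrakk>
        \<Longrightarrow> tgt2 C (hcmp C \<beta> \<alpha>) = tgt2 C \<beta> \<bullet>\<^bsub>C\<^esub> tgt2 C \<alpha>"
    and hcmp_ident2:
      "\<lbrakk>f \<in> Arr C; g \<in> Arr C; tgt C f = src C g\<rbrakk>
        \<Longrightarrow> hcmp C (ident2 C g) (ident2 C f) = ident2 C (g \<bullet>\<^bsub>C\<^esub> f)"
    and interchange:
      "\<lbrakk>\<alpha> \<in> Cell2 C; \<alpha>' \<in> Cell2 C; \<beta> \<in> Cell2 C; \<beta>' \<in> Cell2 C;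
        tgt2 C \<alpha> = src2 C \<alpha>'; tgt2 C \<beta> = src2 C \<beta>'; tgt C (tgt2 C \<alpha>) = src C (src2 C \<beta>)\<rbrakk>
        \<Longrightarrow> hcmp C (vcmp C \<beta>' \<beta>) (vcmp C \<alpha>' \<alpha>) = vcmp C (hcmp C \<beta>' \<alpha>') (hcmp C \<beta> \<alpha>)"


section \<open>Linear algebra\<close>

text \<open>A vector space over a field \<open>K\<close> is a \<open>module\<close> over \<open>K\<close>.  Multilinear maps take tuples, so that
  they can serve as object or arrow parts of functors on product categories.\<close>

definition char_zero :: "('k, 'c) ring_scheme \<Rightarrow> bool"
  where "char_zero K \<longleftrightarrow> (\<forall>n::nat. 0 < n \<longrightarrow> add_pow K n \<one>\<^bsub>K\<^esub> \<noteq> \<zero>\<^bsub>K\<^esub>)"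

definition linear_map ::
    "('k, 'c) ring_scheme \<Rightarrow> ('k, 'v, 'x) module_scheme \<Rightarrow> ('k, 'w, 'y) module_scheme
      \<Rightarrow> ('v \<Rightarrow> 'w) \<Rightarrow> bool"
  where "linear_map K V W f \<longleftrightarrow>
    f \<in> carrier V \<rightarrow> carrier W \<and>
    (\<forall>x\<in>carrier V. \<forall>y\<in>carrier V. f (x \<oplus>\<^bsub>V\<^esub> y) = f x \<oplus>\<^bsub>W\<^esub> f y) \<and>
    (\<forall>a\<in>carrier K. \<forall>x\<in>carrier V. f (a \<odot>\<^bsub>V\<^esub> x) = a \<odot>\<^bsub>W\<^esub> f x)"

definition bilinear_map ::
    "('k, 'c) ring_scheme \<Rightarrow> ('k, 'u, 'x) module_scheme \<Rightarrow> ('k, 'v, 'y) module_scheme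
      \<Rightarrow> ('k, 'w, 'z) module_scheme \<Rightarrow> ('u \<times> 'v \<Rightarrow> 'w) \<Rightarrow> bool"
  where "bilinear_map K U V W f \<longleftrightarrow>
    (\<forall>x\<in>carrier U. linear_map K V W (\<lambda>y. f (x, y))) \<and>
    (\<forall>y\<in>carrier V. linear_map K U W (\<lambda>x. f (x, y)))"

definition trilinear_map ::
    "('k, 'c) ring_scheme \<Rightarrow> ('k, 't, 's) module_scheme \<Rightarrow> ('k, 'u, 'x) module_scheme
      \<Rightarrow> ('k, 'v, 'y) module_scheme \<Rightarrow> ('k, 'w, 'z) module_scheme \<Rightarrow> ('t \<times> 'u \<times> 'v \<Rightarrow> 'w) \<Rightarrow> bool"
  where "trilinear_map K T U V W f \<longleftrightarrow>
    (\<forall>x\<in>carrier T. \<forall>y\<in>carrier U. linear_map K V W (\<lambda>z. f (x, y, z))) \<and>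
    (\<forall>x\<in>carrier T. \<forall>z\<in>carrier V. linear_map K U W (\<lambda>y. f (x, y, z))) \<and>
    (\<forall>y\<in>carrier U. \<forall>z\<in>carrier V. linear_map K T W (\<lambda>x. f (x, y, z)))"


section \<open>Linear categories\<close>

record ('k, 'o, 'm) lin_cat = "('o, 'm) cat" +
  obj_space :: "('k, 'o) module"
  arr_space :: "('k, 'm) module"

abbreviation obj_add ::
    "('k, 'o, 'm, 'z) lin_cat_scheme \<Rightarrow> 'o \<Rightarrow> 'o \<Rightarrow> 'o" (infixl "\<boxplus>\<index>" 65)
  where "x \<boxplus>\<^bsub>L\<^esub> y \<equiv> x \<oplus>\<^bsub>obj_space L\<^esub> y"

abbreviation arr_add ::
    "('k, 'o, 'm, 'z) lin_cat_scheme \<Rightarrow> 'm \<Rightarrow> 'm \<Rightarrow> 'm" (infixl "\<uplus>\<index>" 65)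
  where "f \<uplus>\<^bsub>L\<^esub> g \<equiv> f \<oplus>\<^bsub>arr_space L\<^esub> g"

text \<open>The last two axioms are linearity of composition as a map on the vector space of composable
  pairs, i.e. on the pullback of \<open>src\<close> and \<open>tgt\<close>.\<close>

locale lin_category = category L
  for K :: "('k, 'c) ring_scheme" and L :: "('k, 'o, 'm, 'z) lin_cat_scheme" +
  assumes obj_space: "module K (obj_space L)"
    and arr_space: "module K (arr_space L)"
    and Obj_eq: "Obj L = carrier (obj_space L)"
    and Arr_eq: "Arr L = carrier (arr_space L)"
    and linear_src: "linear_map K (arr_space L) (obj_space L) (src L)"
    and linear_tgt: "linear_map K (arr_space L) (obj_space L) (tgt L)"
    and linear_ident: "linear_map K (obj_space L) (arr_space L) (ident L)"
    and cmp_add: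
      "\<lbrakk>f \<in> Arr L; g \<in> Arr L; f' \<in> Arr L; g' \<in> Arr L; tgt L f = src L g; tgt L f' = src L g'\<rbrakk>
        \<Longrightarrow> (g \<uplus>\<^bsub>L\<^esub> g') \<bullet>\<^bsub>L\<^esub> (f \<uplus>\<^bsub>L\<^esub> f') = (g \<bullet>\<^bsub>L\<^esub> f) \<uplus>\<^bsub>L\<^esub> (g' \<bullet>\<^bsub>L\<^esub> f')"
    and cmp_smult:
      "\<lbrakk>a \<in> carrier K; f \<in> Arr L; g \<in> Arr L; tgt L f = src L g\<rbrakk>
        \<Longrightarrow> (a \<odot>\<^bsub>arr_space L\<^esub> g) \<bullet>\<^bsub>L\<^esub> (a \<odot>\<^bsub>arr_space L\<^esub> f) = a \<odot>\<^bsub>arr_space L\<^esub> (g \<bullet>\<^bsub>L\<^esub> f)"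


section \<open>Leibniz 2-algebras\<close>

record ('k, 'o, 'm) leib2 = "('k, 'o, 'm) lin_cat" +
  bracket :: "('o \<times> 'o, 'm \<times> 'm, 'o, 'm) fctr"
  Jac :: "'o \<times> 'o \<times> 'o \<Rightarrow> 'm"

abbreviation bracket_ob ::
    "('k, 'o, 'm, 'z) leib2_scheme \<Rightarrow> 'o \<Rightarrow> 'o \<Rightarrow> 'o" ("\<langle>_,/ _\<rangle>\<index>")
  where "\<langle>x, y\<rangle>\<^bsub>L\<^esub> \<equiv> ob (bracket L) (x, y)"

abbreviation bracket_ar ::
    "('k, 'o, 'm, 'z) leib2_scheme \<Rightarrow> 'm \<Rightarrow> 'm \<Rightarrow> 'm" ("\<llangle>_,/ _\<rrangle>\<index>")
  where "\<llangle>f, g\<rrangle>\<^bsub>L\<^esub> \<equiv> ar (bracket L) (f, g)"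

definition jac_source ::
    "('k, 'o, 'm, 'z) leib2_scheme \<Rightarrow> ('o \<times> 'o \<times> 'o, 'm \<times> 'm \<times> 'm, 'o, 'm) fctr"
  where "jac_source L =
    \<lparr> ob = (\<lambda>(x, y, z). \<langle>x, \<langle>y, z\<rangle>\<^bsub>L\<^esub>\<rangle>\<^bsub>L\<^esub>), ar = (\<lambda>(f, g, h). \<llangle>f, \<llangle>g, h\<rrangle>\<^bsub>L\<^esub>\<rrangle>\<^bsub>L\<^esub>) \<rparr>"

definition jac_target ::
    "('k, 'o, 'm, 'z) leib2_scheme \<Rightarrow> ('o \<times> 'o \<times> 'o, 'm \<times> 'm \<times> 'm, 'o, 'm) fctr"
  where "jac_target L =
    \<lparr> ob = (\<lambda>(x, y, z). \<langle>\<langle>x, y\<rangle>\<^bsub>L\<^esub>, z\<rangle>\<^bsub>L\<^esub> \<boxplus>\<^bsub>L\<^esub> \<langle>y, \<langle>x, z\<rangle>\<^bsub>L\<^esub>\<rangle>\<^bsub>L\<^esub>),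
      ar = (\<lambda>(f, g, h). \<llangle>\<llangle>f, g\<rrangle>\<^bsub>L\<^esub>, h\<rrangle>\<^bsub>L\<^esub> \<uplus>\<^bsub>L\<^esub> \<llangle>g, \<llangle>f, h\<rrangle>\<^bsub>L\<^esub>\<rrangle>\<^bsub>L\<^esub>) \<rparr>"

text \<open>In the coherence law the identities on the remaining summands are written out; the arrow
  applied first is the rightmost one.\<close>

locale leibniz_2_algebra = lin_category K L
  for K :: "('k, 'c) ring_scheme" and L :: "('k, 'o, 'm, 'z) leib2_scheme" (structure) +
  assumes bracket_functor: "cat_functor (prod_cat L L) L (bracket L)"
    and bracket_ob_bilinear:
      "bilinear_map K (obj_space L) (obj_space L) (obj_space L) (ob (bracket L))"
    and bracket_ar_bilinear:
      "bilinear_map K (arr_space L) (arr_space L) (arr_space L) (ar (bracket L))"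
    and Jac_natural:
      "nat_trans (prod_cat L (prod_cat L L)) L (jac_source L) (jac_target L) (Jac L)"
    and Jac_trilinear:
      "trilinear_map K (obj_space L) (obj_space L) (obj_space L) (arr_space L) (Jac L)"
    and Jac_coherence:
      "\<lbrakk>w \<in> Obj L; x \<in> Obj L; y \<in> Obj L; z \<in> Obj L\<rbrakk> \<Longrightarrow>
        (\<llangle>Jac L (w, x, y), ident L z\<rrangle>
          \<uplus> ident L (\<langle>\<langle>x, y\<rangle>, \<langle>w, z\<rangle>\<rangle> \<boxplus> \<langle>\<langle>w, y\<rangle>, \<langle>x, z\<rangle>\<rangle> \<boxplus> \<langle>y, \<langle>\<langle>w, x\<rangle>, z\<rangle>\<rangle> \<boxplus> \<langle>y, \<langle>x, \<langle>w, z\<rangle>\<rangle>\<rangle>))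
        \<bullet> (ident L (\<langle>\<langle>w, \<langle>x, y\<rangle>\<rangle>, z\<rangle> \<boxplus> \<langle>\<langle>x, y\<rangle>, \<langle>w, z\<rangle>\<rangle> \<boxplus> \<langle>\<langle>w, y\<rangle>, \<langle>x, z\<rangle>\<rangle>)
          \<uplus> \<llangle>ident L y, Jac L (w, x, z)\<rrangle>)
        \<bullet> (Jac L (w, \<langle>x, y\<rangle>, z) \<uplus> Jac L (w, y, \<langle>x, z\<rangle>))
        \<bullet> \<llangle>ident L w, Jac L (x, y, z)\<rrangle>
        =
        (Jac L (\<langle>w, x\<rangle>, y, z) \<uplus> Jac L (x, \<langle>w, y\<rangle>, z) \<uplus> Jac L (x, y, \<langle>w, z\<rangle>))
        \<bullet> (ident L \<langle>\<langle>w, x\<rangle>, \<langle>y, z\<rangle>\<rangle> \<uplus> \<llangle>ident L x, Jac L (w, y, z)\<rrangle>)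
        \<bullet> Jac L (w, x, \<langle>y, z\<rangle>)"


section \<open>Morphisms and 2-morphisms\<close>

definition linear_functor ::
    "('k, 'c) ring_scheme \<Rightarrow> ('k, 'o, 'm, 'y) lin_cat_scheme \<Rightarrow> ('k, 'p, 'n, 'z) lin_cat_scheme
      \<Rightarrow> ('o, 'm, 'p, 'n) fctr \<Rightarrow> bool"
  where "linear_functor K L L' F \<longleftrightarrow>
    cat_functor L L' F \<and>
    linear_map K (obj_space L) (obj_space L') (ob F) \<and>
    linear_map K (arr_space L) (arr_space L') (ar F)"

locale leibniz_morphism = L: leibniz_2_algebra K L + L': leibniz_2_algebra K L'
  for K :: "('k, 'c) ring_scheme"
    and L :: "('k, 'o, 'm, 'y) leib2_scheme" and L' :: "('k, 'p, 'n, 'z) leib2_scheme" +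
  fixes F :: "('o, 'm, 'p, 'n) fctr" and \<Phi> :: "'o \<times> 'o \<Rightarrow> 'n"
  assumes linear: "linear_functor K L L' F"
    and natural:
      "nat_trans (prod_cat L L) L'
        (comp_functor (bracket L') (prod_functor F F)) (comp_functor F (bracket L)) \<Phi>"
    and bilinear: "bilinear_map K (obj_space L) (obj_space L) (arr_space L') \<Phi>"
    and coherence:
      "\<lbrakk>x \<in> Obj L; y \<in> Obj L; z \<in> Obj L\<rbrakk> \<Longrightarrow>
        (\<Phi> (\<langle>x, y\<rangle>\<^bsub>L\<^esub>, z) \<uplus>\<^bsub>L'\<^esub> \<Phi> (y, \<langle>x, z\<rangle>\<^bsub>L\<^esub>))
        \<bullet>\<^bsub>L'\<^esub> (\<llangle>\<Phi> (x, y), ident L' (ob F z)\<rrangle>\<^bsub>L'\<^esub> \<uplus>\<^bsub>L'\<^esub> \<llangle>ident L' (ob F y), \<Phi> (x, z)\<rrangle>\<^bsub>L'\<^esub>)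
        \<bullet>\<^bsub>L'\<^esub> Jac L' (ob F x, ob F y, ob F z)
        =
        ar F (Jac L (x, y, z))
        \<bullet>\<^bsub>L'\<^esub> \<Phi> (x, \<langle>y, z\<rangle>\<^bsub>L\<^esub>)
        \<bullet>\<^bsub>L'\<^esub> \<llangle>ident L' (ob F x), \<Phi> (y, z)\<rrangle>\<^bsub>L'\<^esub>"

locale leibniz_2_morphism =
  F: leibniz_morphism K L L' F \<Phi> + G: leibniz_morphism K L L' G \<Gamma>
  for K :: "('k, 'c) ring_scheme"
    and L :: "('k, 'o, 'm, 'y) leib2_scheme" and L' :: "('k, 'p, 'n, 'z) leib2_scheme"
    and F :: "('o, 'm, 'p, 'n) fctr" and \<Phi> :: "'o \<times> 'o \<Rightarrow> 'n"
    and G :: "('o, 'm, 'p, 'n) fctr" and \<Gamma> :: "'o \<times> 'o \<Rightarrow> 'n" +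
  fixes \<theta> :: "'o \<Rightarrow> 'n"
  assumes natural: "nat_trans L L' F G \<theta>"
    and linear: "linear_map K (obj_space L) (arr_space L') \<theta>"
    and compatible:
      "\<lbrakk>x \<in> Obj L; y \<in> Obj L\<rbrakk> \<Longrightarrow>
        \<theta> \<langle>x, y\<rangle>\<^bsub>L\<^esub> \<bullet>\<^bsub>L'\<^esub> \<Phi> (x, y) = \<Gamma> (x, y) \<bullet>\<^bsub>L'\<^esub> \<llangle>\<theta> x, \<theta> y\<rrangle>\<^bsub>L'\<^esub>"


section \<open>The cells of Lei2Alg\<close>

record ('k, 'o, 'm) lmor =
  mdom :: "('k, 'o, 'm) leib2"
  mcod :: "('k, 'o, 'm) leib2"
  mfun :: "('o, 'm, 'o, 'm) fctr"
  mtrans :: "'o \<times> 'o \<Rightarrow> 'm"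

record ('k, 'o, 'm) l2mor =
  tdom :: "('k, 'o, 'm) lmor"
  tcod :: "('k, 'o, 'm) lmor"
  tcomp :: "'o \<Rightarrow> 'm"

definition lei_cells0 :: "('k, 'c) ring_scheme \<Rightarrow> ('k, 'o, 'm) leib2 set"
  where "lei_cells0 K = {L. leibniz_2_algebra K L}"

definition lei_cells1 :: "('k, 'c) ring_scheme \<Rightarrow> ('k, 'o, 'm) lmor set"
  where "lei_cells1 K = {F.
    leibniz_morphism K (mdom F) (mcod F) (mfun F) (mtrans F) \<and>
    extensional_functor (mdom F) (mfun F) \<and>
    mtrans F \<in> extensional (Obj (mdom F) \<times> Obj (mdom F))}"

definition lei_cells2 :: "('k, 'c) ring_scheme \<Rightarrow> ('k, 'o, 'm) l2mor set"
  where "lei_cells2 K = {\<theta>.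
    tdom \<theta> \<in> lei_cells1 K \<and> tcod \<theta> \<in> lei_cells1 K \<and>
    mdom (tdom \<theta>) = mdom (tcod \<theta>) \<and> mcod (tdom \<theta>) = mcod (tcod \<theta>) \<and>
    leibniz_2_morphism K (mdom (tdom \<theta>)) (mcod (tdom \<theta>))
      (mfun (tdom \<theta>)) (mtrans (tdom \<theta>)) (mfun (tcod \<theta>)) (mtrans (tcod \<theta>)) (tcomp \<theta>) \<and>
    tcomp \<theta> \<in> extensional (Obj (mdom (tdom \<theta>)))}"

definition lei_id1 :: "('k, 'o, 'm) leib2 \<Rightarrow> ('k, 'o, 'm) lmor"
  where "lei_id1 L =
    \<lparr> mdom = L, mcod = L, mfun = restrict_functor L id_functor,
      mtrans = id_trans (prod_cat L L) L (bracket L) \<rparr>"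

definition lei_comp1 :: "('k, 'o, 'm) lmor \<Rightarrow> ('k, 'o, 'm) lmor \<Rightarrow> ('k, 'o, 'm) lmor"
  where "lei_comp1 G F =
    \<lparr> mdom = mdom F, mcod = mcod G,
      mfun = restrict_functor (mdom F) (comp_functor (mfun G) (mfun F)),
      mtrans = (\<lambda>(x, y) \<in> Obj (mdom F) \<times> Obj (mdom F).
        ar (mfun G) (mtrans F (x, y)) \<bullet>\<^bsub>mcod G\<^esub> mtrans G (ob (mfun F) x, ob (mfun F) y)) \<rparr>"

definition lei_id2 :: "('k, 'o, 'm) lmor \<Rightarrow> ('k, 'o, 'm) l2mor"
  where "lei_id2 F =
    \<lparr> tdom = F, tcod = F, tcomp = id_trans (mdom F) (mcod F) (mfun F) \<rparr>"

definition lei_vcomp :: "('k, 'o, 'm) l2mor \<Rightarrow> ('k, 'o, 'm) l2mor \<Rightarrow> ('k, 'o, 'm) l2mor"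
  where "lei_vcomp \<eta> \<theta> =
    \<lparr> tdom = tdom \<theta>, tcod = tcod \<eta>,
      tcomp = vcomp_trans (mdom (tdom \<theta>)) (mcod (tdom \<theta>)) (tcomp \<eta>) (tcomp \<theta>) \<rparr>"

definition lei_hcomp :: "('k, 'o, 'm) l2mor \<Rightarrow> ('k, 'o, 'm) l2mor \<Rightarrow> ('k, 'o, 'm) l2mor"
  where "lei_hcomp \<eta> \<theta> =
    \<lparr> tdom = lei_comp1 (tdom \<eta>) (tdom \<theta>), tcod = lei_comp1 (tcod \<eta>) (tcod \<theta>),
      tcomp = hcomp_trans (mdom (tdom \<theta>)) (mcod (tdom \<eta>))
        (mfun (tdom \<eta>)) (mfun (tcod \<theta>)) (tcomp \<eta>) (tcomp \<theta>) \<rparr>"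

text \<open>All 0-cells have their spaces of objects and of morphisms carried by subsets of the two types
  \<open>'o\<close> and \<open>'m\<close>, which play the role of the universe.\<close>

definition Lei2Alg ::
    "('k, 'c) ring_scheme
      \<Rightarrow> (('k, 'o, 'm) leib2, ('k, 'o, 'm) lmor, ('k, 'o, 'm) l2mor) two_cat"
  where "Lei2Alg K =
    \<lparr> Obj = lei_cells0 K, Arr = lei_cells1 K, src = mdom, tgt = mcod,
      ident = lei_id1, cmp = lei_comp1,
      Cell2 = lei_cells2 K, src2 = tdom, tgt2 = tcod,
      ident2 = lei_id2, vcmp = lei_vcomp, hcmp = lei_hcomp \<rparr>"

end

theory Submission
  imports Defs
begin

text \<open>The 2-category axioms for Leibniz 2-algebras are inherited from linear categories, functors
  and natural transformations, where they come down to associativity, functoriality and, for the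
  interchange law, one naturality square.  What has to be proved beyond this is that identities and
  composites are again compatible with the brackets and the Jacobiators.  Linearity is never an
  obstacle, because composition of morphisms is linear on composable pairs
  (\<open>lin_category.linear_map_cmp\<close>).

  The main step is that the composite \<open>GF\<close> of morphisms \<open>(F, \<Phi>)\<close> and \<open>(G, \<Gamma>)\<close>, equipped with \<open>\<Psi>\<^sub>x\<^sub>y = G \<Phi>\<^sub>x\<^sub>y \<bullet> \<Gamma>\<^sub>F\<^sub>x\<^sub>,\<^sub>F\<^sub>y\<close>, satisfies the
  coherence law for the Jacobiators (\<open>leibniz_morphism_comp\<close>).  Functoriality of the bracket and
  linearity of composition split the composite for \<open>\<Psi>\<close> into factors \<open>G \<Phi>\<close> and factors \<open>\<Gamma>\<close>.
  Naturality of \<open>\<Gamma>\<close> with respect to the arrows \<open>\<Phi>\<close> moves all the \<open>\<Gamma>\<close>'s next to the Jacobiator of the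
  last algebra.  There the law for \<open>(G, \<Gamma>)\<close> replaces it by \<open>G\<close> of the Jacobiator in the middle, and
  the image under \<open>G\<close> of the law for \<open>(F, \<Phi>)\<close> replaces that one in turn; one more naturality square
  puts the factors back in order.  For the horizontal composite of \<open>\<theta>\<close> followed by \<open>\<eta>\<close> the
  compatibility law comes in the same way from the laws for \<open>\<theta>\<close> and \<open>\<eta>\<close>, together with naturality
  of \<open>\<eta>\<close> and of the structure transformation of its source (\<open>leibniz_2_morphism_hcomp\<close>).

  The cells of the 2-category are functions normalised to be undefined off the carriers, so an equation
  between cells can be checked on objects and morphisms (\<open>lei_cells1_eqI\<close>, \<open>lei_cells2_eqI\<close>).  The
  coherence computations themselves are done for arbitrary functors and transformations;
  \<open>leibniz_morphism_restrict\<close> and \<open>leibniz_2_morphism_restrict\<close> carry them over to the normalised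
  cells.\<close>

section \<open>Functors and natural transformations\<close>

context category
begin

lemmas cat_simps [simp] = src_closed tgt_closed ident_closed src_ident tgt_ident
  cmp_closed src_cmp tgt_cmp cmp_assoc cmp_ident_right cmp_ident_left

text \<open>The identity need not literally be the one at \<open>src C f\<close>: the simplifier rewrites sources and
  targets to objects before these laws can match.\<close>

lemma cmp_ident_right' [simp]: "f \<in> Arr C \<Longrightarrow> src C f = x \<Longrightarrow> f \<bullet> ident C x = f"
  using cmp_ident_right by blast

lemma cmp_ident_left' [simp]: "f \<in> Arr C \<Longrightarrow> tgt C f = x \<Longrightarrow> ident C x \<bullet> f = f"
  using cmp_ident_left by blast

end

declare (in cat_functor) ob_closed [simp] ar_closed [simp] src_ar [simp] tgt_ar [simp]
  ar_ident [simp] ar_cmp [simp]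

declare (in nat_trans) component_closed [simp] src_component [simp] tgt_component [simp]

lemma prod_cat_sel [simp]:
  "Obj (prod_cat C D) = Obj C \<times> Obj D"
  "Arr (prod_cat C D) = Arr C \<times> Arr D"
  "src (prod_cat C D) (f, g) = (src C f, src D g)"
  "tgt (prod_cat C D) (f, g) = (tgt C f, tgt D g)"
  "ident (prod_cat C D) (x, y) = (ident C x, ident D y)"
  "cmp (prod_cat C D) (f, g) (f', g') = (f \<bullet>\<^bsub>C\<^esub> f', g \<bullet>\<^bsub>D\<^esub> g')"
  by (simp_all add: prod_cat_def)

lemma comp_functor_sel [simp]:
  "ob (comp_functor G F) = (\<lambda>x. ob G (ob F x))" "ar (comp_functor G F) = (\<lambda>f. ar G (ar F f))"
  by (simp_all add: comp_functor_def comp_def)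

lemma prod_functor_sel [simp]:
  "ob (prod_functor F G) (x, y) = (ob F x, ob G y)"
  "ar (prod_functor F G) (f, g) = (ar F f, ar G g)"
  by (simp_all add: prod_functor_def)

lemma id_functor_sel [simp]: "ob id_functor = (\<lambda>x. x)" "ar id_functor = (\<lambda>f. f)"
  by (simp_all add: id_functor_def)

lemma restrict_functor_sel [simp]:
  "x \<in> Obj C \<Longrightarrow> ob (restrict_functor C F) x = ob F x"
  "f \<in> Arr C \<Longrightarrow> ar (restrict_functor C F) f = ar F f"
  by (simp_all add: restrict_functor_def)

lemma extensional_restrict_functor [simp]: "extensional_functor C (restrict_functor C F)"
  by (simp add: extensional_functor_def restrict_functor_def)

lemma extensional_functor_eqI:
  assumes "extensional_functor C F" "extensional_functor C G"
    and "\<And>x. x \<in> Obj C \<Longrightarrow> ob F x = ob G x" "\<And>f. f \<in> Arr C \<Longrightarrow> ar F f = ar G f"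
  shows "F = G"
proof -
  have "ob F = ob G" "ar F = ar G"
    using assms unfolding extensional_functor_def by (auto intro: extensionalityI)
  then show ?thesis by (simp add: fctr.equality)
qed

lemma category_prod_cat:
  assumes "category C" "category D"
  shows "category (prod_cat C D)"
proof -
  interpret C: category C by fact
  interpret D: category D by fact
  show ?thesis by unfold_locales auto
qed

lemma cat_functor_comp:
  assumes "cat_functor C D F" "cat_functor D E G"
  shows "cat_functor C E (comp_functor G F)"
proof -
  interpret F: cat_functor C D F by fact
  interpret G: cat_functor D E G by fact
  show ?thesis by unfold_locales auto
qed

lemma cat_functor_prod:
  assumes "cat_functor C D F" "cat_functor C' D' G"
  shows "cat_functor (prod_cat C C') (prod_cat D D') (prod_functor F G)"
proof -
  interpret F: cat_functor C D F by fact
  interpret G: cat_functor C' D' G by fact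
  interpret CC: category "prod_cat C C'"
    by (intro category_prod_cat F.C.category_axioms G.C.category_axioms)
  interpret DD: category "prod_cat D D'"
    by (intro category_prod_cat F.D.category_axioms G.D.category_axioms)
  show ?thesis by unfold_locales auto
qed

lemma cat_functor_id: "category C \<Longrightarrow> cat_functor C C id_functor"
  by (simp add: cat_functor_def cat_functor_axioms_def)

lemma cat_functor_restrict:
  assumes "cat_functor C D F"
  shows "cat_functor C D (restrict_functor C F)"
proof -
  interpret cat_functor C D F by fact
  show ?thesis by unfold_locales auto
qed

lemma nat_trans_restrict:
  assumes "nat_trans C D F G \<theta>"
  shows "nat_trans C D (restrict_functor C F) (restrict_functor C G) \<theta>"
proof -
  interpret nat_trans C D F G \<theta> by fact
  show ?thesis
    by (intro nat_trans.intro cat_functor_restrict F.cat_functor_axioms G.cat_functor_axioms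
        nat_trans_axioms.intro) (simp_all add: naturality)
qed

lemma nat_trans_id:
  assumes "cat_functor C D F"
  shows "nat_trans C D F F (id_trans C D F)"
proof -
  interpret cat_functor C D F by fact
  show ?thesis by unfold_locales (simp_all add: id_trans_def)
qed

text \<open>Two naturality squares are pasted one above the other.\<close>

lemma nat_trans_vcomp:
  assumes "nat_trans C D F G \<theta>" "nat_trans C D G H \<eta>"
  shows "nat_trans C D F H (vcomp_trans C D \<eta> \<theta>)"
proof -
  interpret \<theta>: nat_trans C D F G \<theta> by fact
  interpret \<eta>: nat_trans C D G H \<eta> by fact
  have "(\<eta> (tgt C f) \<bullet>\<^bsub>D\<^esub> \<theta> (tgt C f)) \<bullet>\<^bsub>D\<^esub> ar F f = ar H f \<bullet>\<^bsub>D\<^esub> (\<eta> (src C f) \<bullet>\<^bsub>D\<^esub> \<theta> (src C f))"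
    if f: "f \<in> Arr C" for f
  proof -
    have "(\<eta> (tgt C f) \<bullet>\<^bsub>D\<^esub> \<theta> (tgt C f)) \<bullet>\<^bsub>D\<^esub> ar F f = \<eta> (tgt C f) \<bullet>\<^bsub>D\<^esub> (ar G f \<bullet>\<^bsub>D\<^esub> \<theta> (src C f))"
      using f by (simp add: \<theta>.naturality)
    also have "\<dots> = (\<eta> (tgt C f) \<bullet>\<^bsub>D\<^esub> ar G f) \<bullet>\<^bsub>D\<^esub> \<theta> (src C f)"
      using f by simp
    also have "\<dots> = (ar H f \<bullet>\<^bsub>D\<^esub> \<eta> (src C f)) \<bullet>\<^bsub>D\<^esub> \<theta> (src C f)"
      using f by (simp only: \<eta>.naturality)
    finally show ?thesis using f by simp
  qed
  then show ?thesis
    by unfold_locales (simp_all add: vcomp_trans_def)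
qed

text \<open>The composite is \<open>\<eta> G \<bullet> F' \<theta>\<close>: its naturality square is the \<open>F'\<close>-image of the square of \<open>\<theta>\<close> at
  \<open>f\<close>, followed by the square of \<open>\<eta>\<close> at \<open>G f\<close>.\<close>

lemma nat_trans_hcomp:
  assumes "nat_trans C D F G \<theta>" "nat_trans D E F' G' \<eta>"
  shows "nat_trans C E (comp_functor F' F) (comp_functor G' G) (hcomp_trans C E F' G \<eta> \<theta>)"
proof -
  interpret \<theta>: nat_trans C D F G \<theta> by fact
  interpret \<eta>: nat_trans D E F' G' \<eta> by fact
  have "(\<eta> (ob G (tgt C f)) \<bullet>\<^bsub>E\<^esub> ar F' (\<theta> (tgt C f))) \<bullet>\<^bsub>E\<^esub> ar F' (ar F f)
      = ar G' (ar G f) \<bullet>\<^bsub>E\<^esub> (\<eta> (ob G (src C f)) \<bullet>\<^bsub>E\<^esub> ar F' (\<theta> (src C f)))"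
    if f: "f \<in> Arr C" for f
  proof -
    have "(\<eta> (ob G (tgt C f)) \<bullet>\<^bsub>E\<^esub> ar F' (\<theta> (tgt C f))) \<bullet>\<^bsub>E\<^esub> ar F' (ar F f)
        = \<eta> (ob G (tgt C f)) \<bullet>\<^bsub>E\<^esub> ar F' (\<theta> (tgt C f) \<bullet>\<^bsub>D\<^esub> ar F f)"
      using f by simp
    also have "\<dots> = \<eta> (ob G (tgt C f)) \<bullet>\<^bsub>E\<^esub> ar F' (ar G f \<bullet>\<^bsub>D\<^esub> \<theta> (src C f))"
      using f by (simp only: \<theta>.naturality)
    also have "\<dots> = (\<eta> (tgt D (ar G f)) \<bullet>\<^bsub>E\<^esub> ar F' (ar G f)) \<bullet>\<^bsub>E\<^esub> ar F' (\<theta> (src C f))"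
      using f by simp
    also have "\<dots> = (ar G' (ar G f) \<bullet>\<^bsub>E\<^esub> \<eta> (src D (ar G f))) \<bullet>\<^bsub>E\<^esub> ar F' (\<theta> (src C f))"
      using f by (simp only: \<eta>.naturality \<theta>.G.ar_closed)
    finally show ?thesis using f by simp
  qed
  then show ?thesis
    by (intro nat_trans.intro cat_functor_comp[where D = D] nat_trans_axioms.intro
        \<theta>.F.cat_functor_axioms \<theta>.G.cat_functor_axioms \<eta>.F.cat_functor_axioms \<eta>.G.cat_functor_axioms)
      (simp_all add: hcomp_trans_def)
qed


section \<open>Linear maps into spaces of morphisms\<close>

lemma linear_map_cong:
  assumes "module K V" "linear_map K V W f" "\<And>x. x \<in> carrier V \<Longrightarrow> g x = f x"
  shows "linear_map K V W g"
proof -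
  interpret module K V by fact
  show ?thesis
    using assms(2,3) by (auto simp: linear_map_def)
qed

lemma linear_map_comp:
  assumes "linear_map K U V f" "linear_map K V W g"
  shows "linear_map K U W (\<lambda>x. g (f x))"
  using assms by (auto simp: linear_map_def Pi_iff)

lemma linear_map_id: "linear_map K V V (\<lambda>x. x)"
  by (simp add: linear_map_def)

lemma bilinear_map_cong:
  assumes "module K U" "module K V" "bilinear_map K U V W f"
    and "\<And>x y. x \<in> carrier U \<Longrightarrow> y \<in> carrier V \<Longrightarrow> g (x, y) = f (x, y)"
  shows "bilinear_map K U V W g"
  using assms unfolding bilinear_map_def
  by (auto intro: linear_map_cong[OF assms(1)] linear_map_cong[OF assms(2)])

lemma bilinear_map_comp_right:
  assumes "bilinear_map K U V W f" "linear_map K W X g"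
  shows "bilinear_map K U V X (\<lambda>p. g (f p))"
  using assms unfolding bilinear_map_def
  by (auto intro: linear_map_comp)

lemma bilinear_map_comp_left:
  assumes "bilinear_map K U V W f" "linear_map K X U h" "linear_map K Y V k"
  shows "bilinear_map K X Y W (\<lambda>(x, y). f (h x, k y))"
proof -
  have h: "h x \<in> carrier U" if "x \<in> carrier X" for x
    using assms(2) that by (auto simp: linear_map_def)
  have k: "k y \<in> carrier V" if "y \<in> carrier Y" for y
    using assms(3) that by (auto simp: linear_map_def)
  show ?thesis
    unfolding bilinear_map_def prod.case
  proof (intro conjI ballI)
    show "linear_map K Y W (\<lambda>y. f (h x, k y))" if "x \<in> carrier X" for x
      by (rule linear_map_comp[OF assms(3)]) (use assms(1) h[OF that] in \<open>simp add: bilinear_map_def\<close>)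
    show "linear_map K X W (\<lambda>x. f (h x, k y))" if "y \<in> carrier Y" for y
      by (rule linear_map_comp[OF assms(2)]) (use assms(1) k[OF that] in \<open>simp add: bilinear_map_def\<close>)
  qed
qed

context lin_category
begin

lemma obj_add_closed [simp]: "x \<in> Obj L \<Longrightarrow> y \<in> Obj L \<Longrightarrow> x \<boxplus>\<^bsub>L\<^esub> y \<in> Obj L"
  using module.axioms(2)[OF obj_space] Obj_eq by (simp add: abelian_group_def abelian_monoid.a_closed)

lemma arr_add_closed [simp]: "f \<in> Arr L \<Longrightarrow> g \<in> Arr L \<Longrightarrow> f \<uplus>\<^bsub>L\<^esub> g \<in> Arr L"
  using module.axioms(2)[OF arr_space] Arr_eq by (simp add: abelian_group_def abelian_monoid.a_closed)

lemma add_simps [simp]: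
  "f \<in> Arr L \<Longrightarrow> g \<in> Arr L \<Longrightarrow> src L (f \<uplus>\<^bsub>L\<^esub> g) = src L f \<boxplus>\<^bsub>L\<^esub> src L g"
  "f \<in> Arr L \<Longrightarrow> g \<in> Arr L \<Longrightarrow> tgt L (f \<uplus>\<^bsub>L\<^esub> g) = tgt L f \<boxplus>\<^bsub>L\<^esub> tgt L g"
  using linear_src linear_tgt Arr_eq by (simp_all add: linear_map_def)

lemma ident_add:
  "x \<in> Obj L \<Longrightarrow> y \<in> Obj L \<Longrightarrow> ident L x \<uplus>\<^bsub>L\<^esub> ident L y = ident L (x \<boxplus>\<^bsub>L\<^esub> y)"
  using linear_ident Obj_eq by (simp add: linear_map_def)

text \<open>Composition is linear only on the space of composable pairs, which is not a product.  All
  composite transformations get their linearity through this pointwise form.\<close>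

lemma linear_map_cmp:
  assumes f: "linear_map K V (arr_space L) f" and g: "linear_map K V (arr_space L) g"
    and fg: "\<And>x. x \<in> carrier V \<Longrightarrow> tgt L (f x) = src L (g x)"
  shows "linear_map K V (arr_space L) (\<lambda>x. g x \<bullet>\<^bsub>L\<^esub> f x)"
proof -
  have c: "f x \<in> Arr L" "g x \<in> Arr L" if "x \<in> carrier V" for x
    using f g that Arr_eq by (auto simp: linear_map_def)
  show ?thesis
    using f g c fg unfolding linear_map_def
    by (simp add: Arr_eq[symmetric] cmp_add cmp_smult)
qed

lemma bilinear_map_cmp:
  assumes "bilinear_map K U V (arr_space L) f" and "bilinear_map K U V (arr_space L) g"
    and "\<And>x y. x \<in> carrier U \<Longrightarrow> y \<in> carrier V \<Longrightarrow> tgt L (f (x, y)) = src L (g (x, y))"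
  shows "bilinear_map K U V (arr_space L) (\<lambda>p. g p \<bullet>\<^bsub>L\<^esub> f p)"
  using assms unfolding bilinear_map_def by (auto intro: linear_map_cmp)

end


section \<open>Leibniz 2-algebras and their morphisms, pointwise\<close>

context leibniz_2_algebra
begin

interpretation B: cat_functor "prod_cat L L" L "bracket L"
  by (rule bracket_functor)

lemma bracket_simps [simp]:
  "x \<in> Obj L \<Longrightarrow> y \<in> Obj L \<Longrightarrow> \<langle>x, y\<rangle> \<in> Obj L"
  "f \<in> Arr L \<Longrightarrow> g \<in> Arr L \<Longrightarrow> \<llangle>f, g\<rrangle> \<in> Arr L"
  "f \<in> Arr L \<Longrightarrow> g \<in> Arr L \<Longrightarrow> src L \<llangle>f, g\<rrangle> = \<langle>src L f, src L g\<rangle>"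
  "f \<in> Arr L \<Longrightarrow> g \<in> Arr L \<Longrightarrow> tgt L \<llangle>f, g\<rrangle> = \<langle>tgt L f, tgt L g\<rangle>"
  "x \<in> Obj L \<Longrightarrow> y \<in> Obj L \<Longrightarrow> \<llangle>ident L x, ident L y\<rrangle> = ident L \<langle>x, y\<rangle>"
  using B.ob_closed[of "(x, y)"] B.ar_closed[of "(f, g)"] B.src_ar[of "(f, g)"]
    B.tgt_ar[of "(f, g)"] B.ar_ident[of "(x, y)"] by simp_all

lemma bracket_cmp:
  "\<lbrakk>f \<in> Arr L; g \<in> Arr L; tgt L f = src L g; f' \<in> Arr L; g' \<in> Arr L; tgt L f' = src L g'\<rbrakk>
    \<Longrightarrow> \<llangle>g \<bullet> f, g' \<bullet> f'\<rrangle> = \<llangle>g, g'\<rrangle> \<bullet> \<llangle>f, f'\<rrangle>"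
  using B.ar_cmp[of "(f, f')" "(g, g')"] by simp

lemma Jac_simps [simp]:
  assumes "x \<in> Obj L" "y \<in> Obj L" "z \<in> Obj L"
  shows "Jac L (x, y, z) \<in> Arr L"
    "src L (Jac L (x, y, z)) = \<langle>x, \<langle>y, z\<rangle>\<rangle>"
    "tgt L (Jac L (x, y, z)) = \<langle>\<langle>x, y\<rangle>, z\<rangle> \<boxplus> \<langle>y, \<langle>x, z\<rangle>\<rangle>"
  using nat_trans.component_closed[OF Jac_natural, of "(x, y, z)"]
    nat_trans.src_component[OF Jac_natural, of "(x, y, z)"]
    nat_trans.tgt_component[OF Jac_natural, of "(x, y, z)"] assms
  by (simp_all add: jac_source_def jac_target_def)

end

text \<open>The naturality condition unfolded into statements about pairs of objects and of arrows; the two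
  functors on the product category and their functoriality no longer appear.\<close>

lemma leibniz_morphismI:
  assumes L: "leibniz_2_algebra K L" and L': "leibniz_2_algebra K L'"
    and lin: "linear_functor K L L' F"
    and closed: "\<And>x y. x \<in> Obj L \<Longrightarrow> y \<in> Obj L \<Longrightarrow> \<Phi> (x, y) \<in> Arr L'"
    and src: "\<And>x y. x \<in> Obj L \<Longrightarrow> y \<in> Obj L \<Longrightarrow> src L' (\<Phi> (x, y)) = \<langle>ob F x, ob F y\<rangle>\<^bsub>L'\<^esub>"
    and tgt: "\<And>x y. x \<in> Obj L \<Longrightarrow> y \<in> Obj L \<Longrightarrow> tgt L' (\<Phi> (x, y)) = ob F \<langle>x, y\<rangle>\<^bsub>L\<^esub>"
    and nat: "\<And>f g. f \<in> Arr L \<Longrightarrow> g \<in> Arr L \<Longrightarrow>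
      \<Phi> (tgt L f, tgt L g) \<bullet>\<^bsub>L'\<^esub> \<llangle>ar F f, ar F g\<rrangle>\<^bsub>L'\<^esub> = ar F \<llangle>f, g\<rrangle>\<^bsub>L\<^esub> \<bullet>\<^bsub>L'\<^esub> \<Phi> (src L f, src L g)"
    and bil: "bilinear_map K (obj_space L) (obj_space L) (arr_space L') \<Phi>"
    and coh: "\<And>x y z. \<lbrakk>x \<in> Obj L; y \<in> Obj L; z \<in> Obj L\<rbrakk> \<Longrightarrow>
        (\<Phi> (\<langle>x, y\<rangle>\<^bsub>L\<^esub>, z) \<uplus>\<^bsub>L'\<^esub> \<Phi> (y, \<langle>x, z\<rangle>\<^bsub>L\<^esub>))
        \<bullet>\<^bsub>L'\<^esub> (\<llangle>\<Phi> (x, y), ident L' (ob F z)\<rrangle>\<^bsub>L'\<^esub> \<uplus>\<^bsub>L'\<^esub> \<llangle>ident L' (ob F y), \<Phi> (x, z)\<rrangle>\<^bsub>L'\<^esub>)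
        \<bullet>\<^bsub>L'\<^esub> Jac L' (ob F x, ob F y, ob F z)
        =
        ar F (Jac L (x, y, z))
        \<bullet>\<^bsub>L'\<^esub> \<Phi> (x, \<langle>y, z\<rangle>\<^bsub>L\<^esub>)
        \<bullet>\<^bsub>L'\<^esub> \<llangle>ident L' (ob F x), \<Phi> (y, z)\<rrangle>\<^bsub>L'\<^esub>"
  shows "leibniz_morphism K L L' F \<Phi>"
proof -
  interpret L: leibniz_2_algebra K L by fact
  interpret L': leibniz_2_algebra K L' by fact
  have F: "cat_functor L L' F" using lin by (simp add: linear_functor_def)
  have "nat_trans (prod_cat L L) L'
        (comp_functor (bracket L') (prod_functor F F)) (comp_functor F (bracket L)) \<Phi>"
    by (intro nat_trans.intro cat_functor_comp[where D = "prod_cat L' L'"]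
        cat_functor_comp[where D = L] cat_functor_prod F L.bracket_functor L'.bracket_functor
        nat_trans_axioms.intro)
      (auto simp: closed src tgt nat)
  from leibniz_morphism_axioms.intro[OF lin this bil coh] show ?thesis
    by (intro leibniz_morphism.intro L L')
qed

context leibniz_morphism
begin

sublocale fctr: cat_functor L L' F
  using linear by (simp add: linear_functor_def)

lemma trans_simps [simp]:
  assumes "x \<in> Obj L" "y \<in> Obj L"
  shows "\<Phi> (x, y) \<in> Arr L'"
    "src L' (\<Phi> (x, y)) = \<langle>ob F x, ob F y\<rangle>\<^bsub>L'\<^esub>"
    "tgt L' (\<Phi> (x, y)) = ob F \<langle>x, y\<rangle>\<^bsub>L\<^esub>"
  using nat_trans.component_closed[OF natural, of "(x, y)"]
    nat_trans.src_component[OF natural, of "(x, y)"]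
    nat_trans.tgt_component[OF natural, of "(x, y)"] assms
  by simp_all

lemma trans_naturality:
  assumes "f \<in> Arr L" "g \<in> Arr L"
  shows "\<Phi> (tgt L f, tgt L g) \<bullet>\<^bsub>L'\<^esub> \<llangle>ar F f, ar F g\<rrangle>\<^bsub>L'\<^esub> = ar F \<llangle>f, g\<rrangle>\<^bsub>L\<^esub> \<bullet>\<^bsub>L'\<^esub> \<Phi> (src L f, src L g)"
  using nat_trans.naturality[OF natural, of "(f, g)"] assms by simp

lemma linear_ob: "linear_map K (obj_space L) (obj_space L') (ob F)"
  and linear_ar: "linear_map K (arr_space L) (arr_space L') (ar F)"
  using linear by (simp_all add: linear_functor_def)

lemma ob_add [simp]:
  "x \<in> Obj L \<Longrightarrow> y \<in> Obj L \<Longrightarrow> ob F (x \<boxplus>\<^bsub>L\<^esub> y) = ob F x \<boxplus>\<^bsub>L'\<^esub> ob F y"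
  using linear_ob by (simp add: linear_map_def L.Obj_eq)

lemma ar_add:
  "f \<in> Arr L \<Longrightarrow> g \<in> Arr L \<Longrightarrow> ar F (f \<uplus>\<^bsub>L\<^esub> g) = ar F f \<uplus>\<^bsub>L'\<^esub> ar F g"
  using linear_ar by (simp add: linear_map_def L.Arr_eq)

end

section \<open>Identities and composites of morphisms\<close>

lemma linear_functor_restrict:
  assumes "lin_category K L" "linear_functor K L L' F"
  shows "linear_functor K L L' (restrict_functor L F)"
proof -
  interpret L: lin_category K L by fact
  show ?thesis
    using assms(2) unfolding linear_functor_def
    by (auto intro: cat_functor_restrict linear_map_cong[OF L.obj_space]
        linear_map_cong[OF L.arr_space] simp: L.Obj_eq[symmetric] L.Arr_eq[symmetric])
qed

text \<open>Only values on the carriers enter the axioms of a morphism, so they survive normalisation.\<close>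

lemma leibniz_morphism_restrict:
  assumes "leibniz_morphism K L L' F \<Phi>"
  shows "leibniz_morphism K L L' (restrict_functor L F) (restrict \<Phi> (Obj L \<times> Obj L))"
proof -
  interpret leibniz_morphism K L L' F \<Phi> by fact
  show ?thesis
    by (rule leibniz_morphismI)
      (auto intro: linear_functor_restrict linear L.lin_category_axioms
        L.leibniz_2_algebra_axioms L'.leibniz_2_algebra_axioms coherence
        bilinear_map_cong[OF L.obj_space L.obj_space bilinear]
        simp: trans_naturality L.Obj_eq[symmetric])
qed

text \<open>All factors of the coherence law other than the Jacobiator are identities, since the bracket
  and the addition preserve identities.\<close>

lemma leibniz_morphism_id:
  assumes "leibniz_2_algebra K L"
  shows "leibniz_morphism K L L id_functor (id_trans (prod_cat L L) L (bracket L))"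
proof -
  interpret leibniz_2_algebra K L by fact
  have bil: "bilinear_map K (obj_space L) (obj_space L) (arr_space L)
      (id_trans (prod_cat L L) L (bracket L))"
    by (rule bilinear_map_cong[OF obj_space obj_space
          bilinear_map_comp_right[OF bracket_ob_bilinear linear_ident]])
      (simp add: id_trans_def Obj_eq)
  have "linear_functor K L L id_functor"
    by (simp add: linear_functor_def cat_functor_id category_axioms linear_map_id)
  then show ?thesis
    by (rule leibniz_morphismI[OF assms assms _ _ _ _ _ bil]) (simp_all add: id_trans_def ident_add)
qed

text \<open>In the coherence law for \<open>\<Psi> = G \<Phi> \<bullet> \<Gamma>\<close>, the left-hand side becomes
  \<open>(G ?P \<bullet> ?R) \<bullet> (?S \<bullet> ?T) \<bullet> ?J''\<close>, with \<open>?S\<close> built from the arrows \<open>G \<Phi>\<close> and \<open>?R\<close>, \<open>?T\<close> from \<open>\<Gamma>\<close>.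
  Naturality of \<open>\<Gamma>\<close> turns \<open>?R \<bullet> ?S\<close> into \<open>G ?Q \<bullet> ?R'\<close>.  Then \<open>?R' \<bullet> ?T \<bullet> ?J''\<close> is one side of the law
  for \<open>(G, \<Gamma>)\<close> at the images under \<open>F\<close>, and \<open>?P \<bullet> ?Q \<bullet> ?J'\<close> is one side of the law for \<open>(F, \<Phi>)\<close>.\<close>

lemma leibniz_morphism_comp:
  assumes "leibniz_morphism K L L' F \<Phi>" "leibniz_morphism K L' L'' G \<Gamma>"
  shows "leibniz_morphism K L L'' (comp_functor G F)
    (\<lambda>(x, y). ar G (\<Phi> (x, y)) \<bullet>\<^bsub>L''\<^esub> \<Gamma> (ob F x, ob F y))"
proof -
  interpret F: leibniz_morphism K L L' F \<Phi> by fact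
  interpret G: leibniz_morphism K L' L'' G \<Gamma> by fact
  let ?\<Psi> = "\<lambda>(x, y). ar G (\<Phi> (x, y)) \<bullet>\<^bsub>L''\<^esub> \<Gamma> (ob F x, ob F y)"
  have lin: "linear_functor K L L'' (comp_functor G F)"
    using F.linear G.linear unfolding linear_functor_def
    by (auto intro: cat_functor_comp linear_map_comp)
  have bil: "bilinear_map K (obj_space L) (obj_space L) (arr_space L'') ?\<Psi>"
    using G.L'.bilinear_map_cmp[OF bilinear_map_comp_left[OF G.bilinear F.linear_ob F.linear_ob]
        bilinear_map_comp_right[OF F.bilinear G.linear_ar]]
    by (simp add: case_prod_unfold F.L.Obj_eq[symmetric])
  have nat: "?\<Psi> (tgt L f, tgt L g) \<bullet>\<^bsub>L''\<^esub> \<llangle>ar G (ar F f), ar G (ar F g)\<rrangle>\<^bsub>L''\<^esub>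
      = ar G (ar F \<llangle>f, g\<rrangle>\<^bsub>L\<^esub>) \<bullet>\<^bsub>L''\<^esub> ?\<Psi> (src L f, src L g)"
    if [simp]: "f \<in> Arr L" "g \<in> Arr L" for f g
  proof -
    have "?\<Psi> (tgt L f, tgt L g) \<bullet>\<^bsub>L''\<^esub> \<llangle>ar G (ar F f), ar G (ar F g)\<rrangle>\<^bsub>L''\<^esub>
      = ar G (\<Phi> (tgt L f, tgt L g)) \<bullet>\<^bsub>L''\<^esub>
        (\<Gamma> (tgt L' (ar F f), tgt L' (ar F g)) \<bullet>\<^bsub>L''\<^esub> \<llangle>ar G (ar F f), ar G (ar F g)\<rrangle>\<^bsub>L''\<^esub>)"
      by simp
    also have "\<dots> = ar G (\<Phi> (tgt L f, tgt L g) \<bullet>\<^bsub>L'\<^esub> \<llangle>ar F f, ar F g\<rrangle>\<^bsub>L'\<^esub>)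
        \<bullet>\<^bsub>L''\<^esub> \<Gamma> (ob F (src L f), ob F (src L g))"
      by (subst G.trans_naturality) simp_all
    also have "\<dots> = ar G (ar F \<llangle>f, g\<rrangle>\<^bsub>L\<^esub>) \<bullet>\<^bsub>L''\<^esub> ?\<Psi> (src L f, src L g)"
      by (subst F.trans_naturality) simp_all
    finally show ?thesis .
  qed
  have coh: "(?\<Psi> (\<langle>x, y\<rangle>\<^bsub>L\<^esub>, z) \<uplus>\<^bsub>L''\<^esub> ?\<Psi> (y, \<langle>x, z\<rangle>\<^bsub>L\<^esub>))
        \<bullet>\<^bsub>L''\<^esub> (\<llangle>?\<Psi> (x, y), ident L'' (ob G (ob F z))\<rrangle>\<^bsub>L''\<^esub>
          \<uplus>\<^bsub>L''\<^esub> \<llangle>ident L'' (ob G (ob F y)), ?\<Psi> (x, z)\<rrangle>\<^bsub>L''\<^esub>)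
        \<bullet>\<^bsub>L''\<^esub> Jac L'' (ob G (ob F x), ob G (ob F y), ob G (ob F z))
        =
        ar G (ar F (Jac L (x, y, z)))
        \<bullet>\<^bsub>L''\<^esub> ?\<Psi> (x, \<langle>y, z\<rangle>\<^bsub>L\<^esub>)
        \<bullet>\<^bsub>L''\<^esub> \<llangle>ident L'' (ob G (ob F x)), ?\<Psi> (y, z)\<rrangle>\<^bsub>L''\<^esub>"
    if [simp]: "x \<in> Obj L" "y \<in> Obj L" "z \<in> Obj L" for x y z
  proof -
    \<comment> \<open>The bracket is a functor, so bracketing a composite with an identity gives a composite.\<close>
    have split_l: "\<llangle>?\<Psi> (x, y), ident L'' (ob G (ob F z))\<rrangle>\<^bsub>L''\<^esub>
        = \<llangle>ar G (\<Phi> (x, y)), ident L'' (ob G (ob F z))\<rrangle>\<^bsub>L''\<^esub>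
          \<bullet>\<^bsub>L''\<^esub> \<llangle>\<Gamma> (ob F x, ob F y), ident L'' (ob G (ob F z))\<rrangle>\<^bsub>L''\<^esub>"
      by (subst G.L'.bracket_cmp[symmetric]) simp_all
    have split_r: "\<llangle>ident L'' (ob G (ob F u)), ?\<Psi> (v, w)\<rrangle>\<^bsub>L''\<^esub>
        = \<llangle>ident L'' (ob G (ob F u)), ar G (\<Phi> (v, w))\<rrangle>\<^bsub>L''\<^esub>
          \<bullet>\<^bsub>L''\<^esub> \<llangle>ident L'' (ob G (ob F u)), \<Gamma> (ob F v, ob F w)\<rrangle>\<^bsub>L''\<^esub>"
      if [simp]: "u \<in> Obj L" "v \<in> Obj L" "w \<in> Obj L" for u v w
      by (subst G.L'.bracket_cmp[symmetric]) simp_all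
    \<comment> \<open>Naturality of \<open>\<Gamma>\<close> at \<open>\<Phi>\<close> paired with an identity.\<close>
    have swap_l: "\<Gamma> (ob F \<langle>x, y\<rangle>\<^bsub>L\<^esub>, ob F z) \<bullet>\<^bsub>L''\<^esub> \<llangle>ar G (\<Phi> (x, y)), ident L'' (ob G (ob F z))\<rrangle>\<^bsub>L''\<^esub>
        = ar G \<llangle>\<Phi> (x, y), ident L' (ob F z)\<rrangle>\<^bsub>L'\<^esub> \<bullet>\<^bsub>L''\<^esub> \<Gamma> (\<langle>ob F x, ob F y\<rangle>\<^bsub>L'\<^esub>, ob F z)"
      using G.trans_naturality[of "\<Phi> (x, y)" "ident L' (ob F z)"] by simp
    have swap_r: "\<Gamma> (ob F u, ob F \<langle>v, w\<rangle>\<^bsub>L\<^esub>) \<bullet>\<^bsub>L''\<^esub> \<llangle>ident L'' (ob G (ob F u)), ar G (\<Phi> (v, w))\<rrangle>\<^bsub>L''\<^esub>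
        = ar G \<llangle>ident L' (ob F u), \<Phi> (v, w)\<rrangle>\<^bsub>L'\<^esub> \<bullet>\<^bsub>L''\<^esub> \<Gamma> (ob F u, \<langle>ob F v, ob F w\<rangle>\<^bsub>L'\<^esub>)"
      if [simp]: "u \<in> Obj L" "v \<in> Obj L" "w \<in> Obj L" for u v w
      using G.trans_naturality[of "ident L' (ob F u)" "\<Phi> (v, w)"] by simp
    let ?P = "\<Phi> (\<langle>x, y\<rangle>\<^bsub>L\<^esub>, z) \<uplus>\<^bsub>L'\<^esub> \<Phi> (y, \<langle>x, z\<rangle>\<^bsub>L\<^esub>)"
    let ?Q = "\<llangle>\<Phi> (x, y), ident L' (ob F z)\<rrangle>\<^bsub>L'\<^esub> \<uplus>\<^bsub>L'\<^esub> \<llangle>ident L' (ob F y), \<Phi> (x, z)\<rrangle>\<^bsub>L'\<^esub>"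
    let ?R = "\<Gamma> (ob F \<langle>x, y\<rangle>\<^bsub>L\<^esub>, ob F z) \<uplus>\<^bsub>L''\<^esub> \<Gamma> (ob F y, ob F \<langle>x, z\<rangle>\<^bsub>L\<^esub>)"
    let ?R' = "\<Gamma> (\<langle>ob F x, ob F y\<rangle>\<^bsub>L'\<^esub>, ob F z) \<uplus>\<^bsub>L''\<^esub> \<Gamma> (ob F y, \<langle>ob F x, ob F z\<rangle>\<^bsub>L'\<^esub>)"
    let ?S = "\<llangle>ar G (\<Phi> (x, y)), ident L'' (ob G (ob F z))\<rrangle>\<^bsub>L''\<^esub>
      \<uplus>\<^bsub>L''\<^esub> \<llangle>ident L'' (ob G (ob F y)), ar G (\<Phi> (x, z))\<rrangle>\<^bsub>L''\<^esub>"
    let ?T = "\<llangle>\<Gamma> (ob F x, ob F y), ident L'' (ob G (ob F z))\<rrangle>\<^bsub>L''\<^esub>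
      \<uplus>\<^bsub>L''\<^esub> \<llangle>ident L'' (ob G (ob F y)), \<Gamma> (ob F x, ob F z)\<rrangle>\<^bsub>L''\<^esub>"
    let ?J'' = "Jac L'' (ob G (ob F x), ob G (ob F y), ob G (ob F z))"
    let ?J' = "Jac L' (ob F x, ob F y, ob F z)"
    \<comment> \<open>A sum of composites is the composite of the sums, by linearity of composition.\<close>
    have 1: "?\<Psi> (\<langle>x, y\<rangle>\<^bsub>L\<^esub>, z) \<uplus>\<^bsub>L''\<^esub> ?\<Psi> (y, \<langle>x, z\<rangle>\<^bsub>L\<^esub>) = ar G ?P \<bullet>\<^bsub>L''\<^esub> ?R"
      by (simp add: G.ar_add G.L'.cmp_add)
    have 2: "\<llangle>?\<Psi> (x, y), ident L'' (ob G (ob F z))\<rrangle>\<^bsub>L''\<^esub>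
          \<uplus>\<^bsub>L''\<^esub> \<llangle>ident L'' (ob G (ob F y)), ?\<Psi> (x, z)\<rrangle>\<^bsub>L''\<^esub> = ?S \<bullet>\<^bsub>L''\<^esub> ?T"
      unfolding split_l split_r[OF that(2,1,3)] by (simp add: G.L'.cmp_add)
    have 3: "?R \<bullet>\<^bsub>L''\<^esub> ?S = ar G ?Q \<bullet>\<^bsub>L''\<^esub> ?R'"
      by (simp add: G.ar_add G.L'.cmp_add swap_l swap_r)
    have "(ar G ?P \<bullet>\<^bsub>L''\<^esub> ?R) \<bullet>\<^bsub>L''\<^esub> (?S \<bullet>\<^bsub>L''\<^esub> ?T) \<bullet>\<^bsub>L''\<^esub> ?J''
        = ar G ?P \<bullet>\<^bsub>L''\<^esub> (?R \<bullet>\<^bsub>L''\<^esub> ?S) \<bullet>\<^bsub>L''\<^esub> ?T \<bullet>\<^bsub>L''\<^esub> ?J''"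
      by simp
    also have "\<dots> = (ar G ?P \<bullet>\<^bsub>L''\<^esub> ar G ?Q) \<bullet>\<^bsub>L''\<^esub> (?R' \<bullet>\<^bsub>L''\<^esub> ?T \<bullet>\<^bsub>L''\<^esub> ?J'')"
      unfolding 3 by simp
    also have "?R' \<bullet>\<^bsub>L''\<^esub> ?T \<bullet>\<^bsub>L''\<^esub> ?J'' = ar G ?J' \<bullet>\<^bsub>L''\<^esub> \<Gamma> (ob F x, \<langle>ob F y, ob F z\<rangle>\<^bsub>L'\<^esub>)
        \<bullet>\<^bsub>L''\<^esub> \<llangle>ident L'' (ob G (ob F x)), \<Gamma> (ob F y, ob F z)\<rrangle>\<^bsub>L''\<^esub>"
      by (rule G.coherence) simp_all
    also have "(ar G ?P \<bullet>\<^bsub>L''\<^esub> ar G ?Q) \<bullet>\<^bsub>L''\<^esub> \<dots> = ar G (?P \<bullet>\<^bsub>L'\<^esub> ?Q \<bullet>\<^bsub>L'\<^esub> ?J')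
        \<bullet>\<^bsub>L''\<^esub> \<Gamma> (ob F x, \<langle>ob F y, ob F z\<rangle>\<^bsub>L'\<^esub>)
        \<bullet>\<^bsub>L''\<^esub> \<llangle>ident L'' (ob G (ob F x)), \<Gamma> (ob F y, ob F z)\<rrangle>\<^bsub>L''\<^esub>"
      by simp
    also have "?P \<bullet>\<^bsub>L'\<^esub> ?Q \<bullet>\<^bsub>L'\<^esub> ?J' = ar F (Jac L (x, y, z)) \<bullet>\<^bsub>L'\<^esub> \<Phi> (x, \<langle>y, z\<rangle>\<^bsub>L\<^esub>)
        \<bullet>\<^bsub>L'\<^esub> \<llangle>ident L' (ob F x), \<Phi> (y, z)\<rrangle>\<^bsub>L'\<^esub>"
      by (rule F.coherence) simp_all
    also have "ar G \<dots> \<bullet>\<^bsub>L''\<^esub> \<Gamma> (ob F x, \<langle>ob F y, ob F z\<rangle>\<^bsub>L'\<^esub>)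
        \<bullet>\<^bsub>L''\<^esub> \<llangle>ident L'' (ob G (ob F x)), \<Gamma> (ob F y, ob F z)\<rrangle>\<^bsub>L''\<^esub>
      = ar G (ar F (Jac L (x, y, z))) \<bullet>\<^bsub>L''\<^esub> ar G (\<Phi> (x, \<langle>y, z\<rangle>\<^bsub>L\<^esub>))
        \<bullet>\<^bsub>L''\<^esub> (ar G \<llangle>ident L' (ob F x), \<Phi> (y, z)\<rrangle>\<^bsub>L'\<^esub> \<bullet>\<^bsub>L''\<^esub> \<Gamma> (ob F x, \<langle>ob F y, ob F z\<rangle>\<^bsub>L'\<^esub>))
        \<bullet>\<^bsub>L''\<^esub> \<llangle>ident L'' (ob G (ob F x)), \<Gamma> (ob F y, ob F z)\<rrangle>\<^bsub>L''\<^esub>"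
      by simp
    also have "\<dots> = ar G (ar F (Jac L (x, y, z)))
        \<bullet>\<^bsub>L''\<^esub> ?\<Psi> (x, \<langle>y, z\<rangle>\<^bsub>L\<^esub>)
        \<bullet>\<^bsub>L''\<^esub> \<llangle>ident L'' (ob G (ob F x)), ?\<Psi> (y, z)\<rrangle>\<^bsub>L''\<^esub>"
      unfolding swap_r[OF that, symmetric] split_r[OF that] by simp
    finally show ?thesis unfolding 1 2 .
  qed
  show ?thesis
    by (rule leibniz_morphismI[OF F.L.leibniz_2_algebra_axioms G.L'.leibniz_2_algebra_axioms lin
          _ _ _ _ bil])
      (use nat coh in simp_all)
qed

section \<open>Identities and composites of 2-morphisms\<close>

sublocale leibniz_2_morphism \<subseteq> trans: nat_trans L L' F G \<theta>
  by (rule natural)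

lemma leibniz_2_morphism_restrict:
  assumes "leibniz_2_morphism K L L' F \<Phi> G \<Gamma> \<theta>"
  shows "leibniz_2_morphism K L L'
    (restrict_functor L F) (restrict \<Phi> (Obj L \<times> Obj L))
    (restrict_functor L G) (restrict \<Gamma> (Obj L \<times> Obj L)) \<theta>"
proof -
  interpret leibniz_2_morphism K L L' F \<Phi> G \<Gamma> \<theta> by fact
  show ?thesis
    by (intro leibniz_2_morphism.intro leibniz_morphism_restrict F.leibniz_morphism_axioms G.leibniz_morphism_axioms
        leibniz_2_morphism_axioms.intro nat_trans_restrict natural linear)
      (simp add: compatible)
qed

lemma leibniz_2_morphism_id:
  assumes "leibniz_morphism K L L' F \<Phi>"
  shows "leibniz_2_morphism K L L' F \<Phi> F \<Phi> (id_trans L L' F)"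
proof -
  interpret leibniz_morphism K L L' F \<Phi> by fact
  have "linear_map K (obj_space L) (arr_space L') (id_trans L L' F)"
    by (rule linear_map_cong[OF L.obj_space linear_map_comp[OF linear_ob L'.linear_ident]])
      (simp add: id_trans_def L.Obj_eq)
  then show ?thesis
    by (intro leibniz_2_morphism.intro assms leibniz_2_morphism_axioms.intro nat_trans_id
        fctr.cat_functor_axioms) (simp_all add: id_trans_def)
qed

lemma leibniz_2_morphism_vcomp:
  assumes "leibniz_2_morphism K L L' F \<Phi> G \<Gamma> \<theta>" "leibniz_2_morphism K L L' G \<Gamma> H \<Lambda> \<eta>"
  shows "leibniz_2_morphism K L L' F \<Phi> H \<Lambda> (vcomp_trans L L' \<eta> \<theta>)"
proof -
  interpret \<theta>: leibniz_2_morphism K L L' F \<Phi> G \<Gamma> \<theta> by fact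
  interpret \<eta>: leibniz_2_morphism K L L' G \<Gamma> H \<Lambda> \<eta> by fact
  have lin: "linear_map K (obj_space L) (arr_space L') (vcomp_trans L L' \<eta> \<theta>)"
    by (rule linear_map_cong[OF \<theta>.F.L.obj_space \<theta>.F.L'.linear_map_cmp[OF \<theta>.linear \<eta>.linear]])
      (simp_all add: vcomp_trans_def \<theta>.F.L.Obj_eq[symmetric])
  have "(\<eta> \<langle>x, y\<rangle>\<^bsub>L\<^esub> \<bullet>\<^bsub>L'\<^esub> \<theta> \<langle>x, y\<rangle>\<^bsub>L\<^esub>) \<bullet>\<^bsub>L'\<^esub> \<Phi> (x, y)
      = \<Lambda> (x, y) \<bullet>\<^bsub>L'\<^esub> \<llangle>\<eta> x \<bullet>\<^bsub>L'\<^esub> \<theta> x, \<eta> y \<bullet>\<^bsub>L'\<^esub> \<theta> y\<rrangle>\<^bsub>L'\<^esub>"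
    if [simp]: "x \<in> Obj L" "y \<in> Obj L" for x y
  proof -
    have "(\<eta> \<langle>x, y\<rangle>\<^bsub>L\<^esub> \<bullet>\<^bsub>L'\<^esub> \<theta> \<langle>x, y\<rangle>\<^bsub>L\<^esub>) \<bullet>\<^bsub>L'\<^esub> \<Phi> (x, y)
        = \<eta> \<langle>x, y\<rangle>\<^bsub>L\<^esub> \<bullet>\<^bsub>L'\<^esub> (\<theta> \<langle>x, y\<rangle>\<^bsub>L\<^esub> \<bullet>\<^bsub>L'\<^esub> \<Phi> (x, y))"
      by simp
    also have "\<dots> = (\<eta> \<langle>x, y\<rangle>\<^bsub>L\<^esub> \<bullet>\<^bsub>L'\<^esub> \<Gamma> (x, y)) \<bullet>\<^bsub>L'\<^esub> \<llangle>\<theta> x, \<theta> y\<rrangle>\<^bsub>L'\<^esub>"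
      unfolding \<theta>.compatible[OF that] by simp
    also have "\<dots> = \<Lambda> (x, y) \<bullet>\<^bsub>L'\<^esub> (\<llangle>\<eta> x, \<eta> y\<rrangle>\<^bsub>L'\<^esub> \<bullet>\<^bsub>L'\<^esub> \<llangle>\<theta> x, \<theta> y\<rrangle>\<^bsub>L'\<^esub>)"
      unfolding \<eta>.compatible[OF that] by simp
    finally show ?thesis by (simp add: \<theta>.F.L'.bracket_cmp)
  qed
  then show ?thesis
    by (intro leibniz_2_morphism.intro \<theta>.F.leibniz_morphism_axioms \<eta>.G.leibniz_morphism_axioms
        leibniz_2_morphism_axioms.intro nat_trans_vcomp[OF \<theta>.natural \<eta>.natural] lin)
      (simp add: vcomp_trans_def)
qed

text \<open>On objects \<open>x\<close>, \<open>y\<close> the arrow \<open>\<eta>\<^sub>G\<^sub>[\<^sub>x\<^sub>,\<^sub>y\<^sub>] \<bullet> F' \<theta>\<^sub>[\<^sub>x\<^sub>,\<^sub>y\<^sub>] \<bullet> F' \<Phi> \<bullet> \<Phi>'\<close> is rewritten from the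
  source side to the target side by four squares: compatibility of \<open>\<theta>\<close> under \<open>F'\<close>, naturality of \<open>\<eta>\<close>
  at \<open>\<Gamma>\<close>, naturality of \<open>\<Phi>'\<close> at the components of \<open>\<theta>\<close>, and compatibility of \<open>\<eta>\<close> at the images under
  \<open>G\<close>.  Functoriality of the bracket merges the two remaining brackets.\<close>

lemma leibniz_2_morphism_hcomp:
  assumes "leibniz_2_morphism K L L' F \<Phi> G \<Gamma> \<theta>" "leibniz_2_morphism K L' L'' F' \<Phi>' G' \<Gamma>' \<eta>"
  shows "leibniz_2_morphism K L L''
    (comp_functor F' F) (\<lambda>(x, y). ar F' (\<Phi> (x, y)) \<bullet>\<^bsub>L''\<^esub> \<Phi>' (ob F x, ob F y))
    (comp_functor G' G) (\<lambda>(x, y). ar G' (\<Gamma> (x, y)) \<bullet>\<^bsub>L''\<^esub> \<Gamma>' (ob G x, ob G y))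
    (hcomp_trans L L'' F' G \<eta> \<theta>)"
proof -
  interpret \<theta>: leibniz_2_morphism K L L' F \<Phi> G \<Gamma> \<theta> by fact
  interpret \<eta>: leibniz_2_morphism K L' L'' F' \<Phi>' G' \<Gamma>' \<eta> by fact
  have lin: "linear_map K (obj_space L) (arr_space L'') (hcomp_trans L L'' F' G \<eta> \<theta>)"
    by (rule linear_map_cong[OF \<theta>.F.L.obj_space \<eta>.F.L'.linear_map_cmp[OF
            linear_map_comp[OF \<theta>.linear \<eta>.F.linear_ar] linear_map_comp[OF \<theta>.G.linear_ob \<eta>.linear]]])
      (simp_all add: hcomp_trans_def \<theta>.F.L.Obj_eq[symmetric])
  have "(\<eta> (ob G \<langle>x, y\<rangle>\<^bsub>L\<^esub>) \<bullet>\<^bsub>L''\<^esub> ar F' (\<theta> \<langle>x, y\<rangle>\<^bsub>L\<^esub>)) \<bullet>\<^bsub>L''\<^esub> (ar F' (\<Phi> (x, y)) \<bullet>\<^bsub>L''\<^esub> \<Phi>' (ob F x, ob F y))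
      = (ar G' (\<Gamma> (x, y)) \<bullet>\<^bsub>L''\<^esub> \<Gamma>' (ob G x, ob G y))
        \<bullet>\<^bsub>L''\<^esub> \<llangle>\<eta> (ob G x) \<bullet>\<^bsub>L''\<^esub> ar F' (\<theta> x), \<eta> (ob G y) \<bullet>\<^bsub>L''\<^esub> ar F' (\<theta> y)\<rrangle>\<^bsub>L''\<^esub>"
    if [simp]: "x \<in> Obj L" "y \<in> Obj L" for x y
  proof -
    have "(\<eta> (ob G \<langle>x, y\<rangle>\<^bsub>L\<^esub>) \<bullet>\<^bsub>L''\<^esub> ar F' (\<theta> \<langle>x, y\<rangle>\<^bsub>L\<^esub>)) \<bullet>\<^bsub>L''\<^esub> (ar F' (\<Phi> (x, y)) \<bullet>\<^bsub>L''\<^esub> \<Phi>' (ob F x, ob F y))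
        = \<eta> (ob G \<langle>x, y\<rangle>\<^bsub>L\<^esub>) \<bullet>\<^bsub>L''\<^esub> ar F' (\<theta> \<langle>x, y\<rangle>\<^bsub>L\<^esub> \<bullet>\<^bsub>L'\<^esub> \<Phi> (x, y)) \<bullet>\<^bsub>L''\<^esub> \<Phi>' (ob F x, ob F y)"
      by simp
    also have "\<dots> = (\<eta> (tgt L' (\<Gamma> (x, y))) \<bullet>\<^bsub>L''\<^esub> ar F' (\<Gamma> (x, y)))
        \<bullet>\<^bsub>L''\<^esub> (ar F' \<llangle>\<theta> x, \<theta> y\<rrangle>\<^bsub>L'\<^esub> \<bullet>\<^bsub>L''\<^esub> \<Phi>' (src L' (\<theta> x), src L' (\<theta> y)))"
      unfolding \<theta>.compatible[OF that] by simp
    also have "\<dots> = (ar G' (\<Gamma> (x, y)) \<bullet>\<^bsub>L''\<^esub> \<eta> (src L' (\<Gamma> (x, y))))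
        \<bullet>\<^bsub>L''\<^esub> (\<Phi>' (tgt L' (\<theta> x), tgt L' (\<theta> y)) \<bullet>\<^bsub>L''\<^esub> \<llangle>ar F' (\<theta> x), ar F' (\<theta> y)\<rrangle>\<^bsub>L''\<^esub>)"
      by (subst \<eta>.trans.naturality, simp, subst \<eta>.F.trans_naturality, simp_all)
    also have "\<dots> = ar G' (\<Gamma> (x, y)) \<bullet>\<^bsub>L''\<^esub> (\<eta> \<langle>ob G x, ob G y\<rangle>\<^bsub>L'\<^esub> \<bullet>\<^bsub>L''\<^esub> \<Phi>' (ob G x, ob G y))
        \<bullet>\<^bsub>L''\<^esub> \<llangle>ar F' (\<theta> x), ar F' (\<theta> y)\<rrangle>\<^bsub>L''\<^esub>"
      by simp
    also have "\<dots> = ar G' (\<Gamma> (x, y)) \<bullet>\<^bsub>L''\<^esub> \<Gamma>' (ob G x, ob G y)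
        \<bullet>\<^bsub>L''\<^esub> (\<llangle>\<eta> (ob G x), \<eta> (ob G y)\<rrangle>\<^bsub>L''\<^esub> \<bullet>\<^bsub>L''\<^esub> \<llangle>ar F' (\<theta> x), ar F' (\<theta> y)\<rrangle>\<^bsub>L''\<^esub>)"
      by (subst \<eta>.compatible) simp_all
    finally show ?thesis by (simp add: \<eta>.F.L'.bracket_cmp)
  qed
  then show ?thesis
    by (intro leibniz_2_morphism.intro
        leibniz_morphism_comp[OF \<theta>.F.leibniz_morphism_axioms \<eta>.F.leibniz_morphism_axioms]
        leibniz_morphism_comp[OF \<theta>.G.leibniz_morphism_axioms \<eta>.G.leibniz_morphism_axioms]
        leibniz_2_morphism_axioms.intro nat_trans_hcomp[OF \<theta>.natural \<eta>.natural] lin)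
      (simp add: hcomp_trans_def)
qed


section \<open>Cells of the 2-category\<close>

text \<open>Domain and codomain are variables so that composable cells can be referred to by one and the same
  name for the algebra between them.\<close>

lemma lei_cells1D:
  assumes "F \<in> lei_cells1 K" "mdom F = A" "mcod F = B"
  shows "leibniz_morphism K A B (mfun F) (mtrans F)"
  using assms by (auto simp: lei_cells1_def)

lemma lei_cells2D:
  assumes "\<theta> \<in> lei_cells2 K" "mdom (tdom \<theta>) = A" "mcod (tdom \<theta>) = B"
  shows "leibniz_2_morphism K A B
      (mfun (tdom \<theta>)) (mtrans (tdom \<theta>)) (mfun (tcod \<theta>)) (mtrans (tcod \<theta>)) (tcomp \<theta>)"
    and "tdom \<theta> \<in> lei_cells1 K" "tcod \<theta> \<in> lei_cells1 K"
    and "mdom (tcod \<theta>) = A" "mcod (tcod \<theta>) = B"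
  using assms by (auto simp: lei_cells2_def)

lemma lei_cells1_eqI:
  assumes FG: "F \<in> lei_cells1 K" "G \<in> lei_cells1 K" and "mdom F = mdom G" "mcod F = mcod G"
    and "\<And>x. x \<in> Obj (mdom G) \<Longrightarrow> ob (mfun F) x = ob (mfun G) x"
    and "\<And>f. f \<in> Arr (mdom G) \<Longrightarrow> ar (mfun F) f = ar (mfun G) f"
    and "\<And>x y. x \<in> Obj (mdom G) \<Longrightarrow> y \<in> Obj (mdom G) \<Longrightarrow> mtrans F (x, y) = mtrans G (x, y)"
  shows "F = G"
proof -
  have "mfun F = mfun G"
    using assms by (auto simp: lei_cells1_def intro: extensional_functor_eqI)
  moreover have "mtrans F = mtrans G"
    using assms by (auto simp: lei_cells1_def intro: extensionalityI)
  ultimately show ?thesis using assms by (simp add: lmor.equality)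
qed

lemma lei_cells2_eqI:
  assumes "\<theta> \<in> lei_cells2 K" "\<eta> \<in> lei_cells2 K" and "tdom \<theta> = tdom \<eta>" "tcod \<theta> = tcod \<eta>"
    and "\<And>x. x \<in> Obj (mdom (tdom \<eta>)) \<Longrightarrow> tcomp \<theta> x = tcomp \<eta> x"
  shows "\<theta> = \<eta>"
proof -
  have "tcomp \<theta> = tcomp \<eta>"
    using assms by (auto simp: lei_cells2_def intro: extensionalityI)
  then show ?thesis using assms by (simp add: l2mor.equality)
qed

lemma lei_id1_sel [simp]:
  "mdom (lei_id1 L) = L" "mcod (lei_id1 L) = L"
  "x \<in> Obj L \<Longrightarrow> ob (mfun (lei_id1 L)) x = x"
  "f \<in> Arr L \<Longrightarrow> ar (mfun (lei_id1 L)) f = f"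
  "x \<in> Obj L \<Longrightarrow> y \<in> Obj L \<Longrightarrow> mtrans (lei_id1 L) (x, y) = ident L \<langle>x, y\<rangle>\<^bsub>L\<^esub>"
  by (simp_all add: lei_id1_def id_trans_def)

lemma lei_comp1_sel [simp]:
  "mdom (lei_comp1 G F) = mdom F" "mcod (lei_comp1 G F) = mcod G"
  "x \<in> Obj (mdom F) \<Longrightarrow> ob (mfun (lei_comp1 G F)) x = ob (mfun G) (ob (mfun F) x)"
  "f \<in> Arr (mdom F) \<Longrightarrow> ar (mfun (lei_comp1 G F)) f = ar (mfun G) (ar (mfun F) f)"
  "x \<in> Obj (mdom F) \<Longrightarrow> y \<in> Obj (mdom F) \<Longrightarrow> mtrans (lei_comp1 G F) (x, y) =
    ar (mfun G) (mtrans F (x, y)) \<bullet>\<^bsub>mcod G\<^esub> mtrans G (ob (mfun F) x, ob (mfun F) y)"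
  by (simp_all add: lei_comp1_def)

lemma lei_id2_sel [simp]:
  "tdom (lei_id2 F) = F" "tcod (lei_id2 F) = F"
  "x \<in> Obj (mdom F) \<Longrightarrow> tcomp (lei_id2 F) x = ident (mcod F) (ob (mfun F) x)"
  by (simp_all add: lei_id2_def id_trans_def)

lemma lei_vcomp_sel [simp]:
  "tdom (lei_vcomp \<eta> \<theta>) = tdom \<theta>" "tcod (lei_vcomp \<eta> \<theta>) = tcod \<eta>"
  "x \<in> Obj (mdom (tdom \<theta>)) \<Longrightarrow>
    tcomp (lei_vcomp \<eta> \<theta>) x = tcomp \<eta> x \<bullet>\<^bsub>mcod (tdom \<theta>)\<^esub> tcomp \<theta> x"
  by (simp_all add: lei_vcomp_def vcomp_trans_def)

lemma lei_hcomp_sel [simp]: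
  "tdom (lei_hcomp \<eta> \<theta>) = lei_comp1 (tdom \<eta>) (tdom \<theta>)"
  "tcod (lei_hcomp \<eta> \<theta>) = lei_comp1 (tcod \<eta>) (tcod \<theta>)"
  "x \<in> Obj (mdom (tdom \<theta>)) \<Longrightarrow> tcomp (lei_hcomp \<eta> \<theta>) x =
    tcomp \<eta> (ob (mfun (tcod \<theta>)) x) \<bullet>\<^bsub>mcod (tdom \<eta>)\<^esub> ar (mfun (tdom \<eta>)) (tcomp \<theta> x)"
  by (simp_all add: lei_hcomp_def hcomp_trans_def)

lemma lei_id1_closed: "leibniz_2_algebra K L \<Longrightarrow> lei_id1 L \<in> lei_cells1 K"
  using leibniz_morphism_restrict[OF leibniz_morphism_id, of K L]
  by (simp add: lei_cells1_def lei_id1_def id_trans_def)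

lemma lei_comp1_closed:
  assumes "F \<in> lei_cells1 K" "G \<in> lei_cells1 K" "mcod F = mdom G"
  shows "lei_comp1 G F \<in> lei_cells1 K"
  using leibniz_morphism_restrict[OF leibniz_morphism_comp[OF
        lei_cells1D[OF assms(1) refl assms(3)] lei_cells1D[OF assms(2) refl refl]]]
  by (simp add: lei_cells1_def lei_comp1_def)

lemma lei_id2_closed: "F \<in> lei_cells1 K \<Longrightarrow> lei_id2 F \<in> lei_cells2 K"
  using leibniz_2_morphism_id[OF lei_cells1D, of F K]
  by (simp add: lei_cells2_def lei_id2_def id_trans_def)

lemma lei_vcomp_closed:
  assumes "\<theta> \<in> lei_cells2 K" "\<eta> \<in> lei_cells2 K" "tcod \<theta> = tdom \<eta>"
  shows "lei_vcomp \<eta> \<theta> \<in> lei_cells2 K"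
proof -
  let ?A = "mdom (tdom \<theta>)" and ?B = "mcod (tdom \<theta>)"
  note \<theta> = lei_cells2D[OF assms(1) refl refl]
  have "mdom (tdom \<eta>) = ?A" "mcod (tdom \<eta>) = ?B"
    using \<theta> assms(3) by simp_all
  note \<eta> = lei_cells2D[OF assms(2) this]
  have "leibniz_2_morphism K ?A ?B (mfun (tdom \<theta>)) (mtrans (tdom \<theta>))
      (mfun (tcod \<eta>)) (mtrans (tcod \<eta>)) (vcomp_trans ?A ?B (tcomp \<eta>) (tcomp \<theta>))"
    by (rule leibniz_2_morphism_vcomp[OF \<theta>(1)]) (use \<eta>(1) assms(3) in simp)
  then show ?thesis
    using \<theta> \<eta> by (simp add: lei_cells2_def lei_vcomp_def vcomp_trans_def)
qed

lemma lei_hcomp_closed: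
  assumes "\<theta> \<in> lei_cells2 K" "\<eta> \<in> lei_cells2 K" "mcod (tdom \<theta>) = mdom (tdom \<eta>)"
  shows "lei_hcomp \<eta> \<theta> \<in> lei_cells2 K"
proof -
  note \<theta> = lei_cells2D[OF assms(1) refl assms(3)]
  note \<eta> = lei_cells2D[OF assms(2) refl refl]
  note leibniz_2_morphism_restrict[OF leibniz_2_morphism_hcomp[OF \<theta>(1) \<eta>(1)]]
  moreover have "lei_comp1 (tdom \<eta>) (tdom \<theta>) \<in> lei_cells1 K" "lei_comp1 (tcod \<eta>) (tcod \<theta>) \<in> lei_cells1 K"
    using \<theta> \<eta> assms(3) by (simp_all add: lei_comp1_closed)
  ultimately show ?thesis
    using \<theta> \<eta> by (simp add: lei_cells2_def lei_hcomp_def lei_comp1_def hcomp_trans_def)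
qed

section \<open>The axioms of a strict 2-category\<close>

text \<open>On structure transformations, both ways of composing give
  \<open>HG \<Phi>\<^sub>x\<^sub>y \<bullet> H \<Gamma>\<^sub>F\<^sub>x\<^sub>,\<^sub>F\<^sub>y \<bullet> \<Lambda>\<^sub>G\<^sub>F\<^sub>x\<^sub>,\<^sub>G\<^sub>F\<^sub>y\<close>, where \<open>\<Phi>\<close>, \<open>\<Gamma>\<close>, \<open>\<Lambda>\<close> belong to \<open>F\<close>, \<open>G\<close>, \<open>H\<close>, because \<open>H\<close>
  preserves composition.\<close>

lemma lei_comp1_assoc:
  assumes F: "F \<in> lei_cells1 K" and G: "G \<in> lei_cells1 K" and H: "H \<in> lei_cells1 K"
    and FG: "mcod F = mdom G" and GH: "mcod G = mdom H"
  shows "lei_comp1 (lei_comp1 H G) F = lei_comp1 H (lei_comp1 G F)"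
proof -
  interpret F: leibniz_morphism K "mdom F" "mdom G" "mfun F" "mtrans F"
    by (rule lei_cells1D[OF F refl FG])
  interpret G: leibniz_morphism K "mdom G" "mdom H" "mfun G" "mtrans G"
    by (rule lei_cells1D[OF G refl GH])
  interpret H: leibniz_morphism K "mdom H" "mcod H" "mfun H" "mtrans H"
    by (rule lei_cells1D[OF H refl refl])
  show ?thesis
    by (rule lei_cells1_eqI[of _ K]) (simp_all add: lei_comp1_closed assms)
qed

lemma lei_comp1_id_right:
  assumes F: "F \<in> lei_cells1 K"
  shows "lei_comp1 F (lei_id1 (mdom F)) = F"
proof -
  interpret F: leibniz_morphism K "mdom F" "mcod F" "mfun F" "mtrans F"
    by (rule lei_cells1D[OF F refl refl])
  show ?thesis
    by (rule lei_cells1_eqI[of _ K])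
      (simp_all add: lei_comp1_closed lei_id1_closed F F.L.leibniz_2_algebra_axioms)
qed

lemma lei_comp1_id_left:
  assumes F: "F \<in> lei_cells1 K"
  shows "lei_comp1 (lei_id1 (mcod F)) F = F"
proof -
  interpret F: leibniz_morphism K "mdom F" "mcod F" "mfun F" "mtrans F"
    by (rule lei_cells1D[OF F refl refl])
  show ?thesis
    by (rule lei_cells1_eqI[of _ K])
      (simp_all add: lei_comp1_closed lei_id1_closed F F.L'.leibniz_2_algebra_axioms)
qed

lemma lei_vcomp_assoc:
  assumes \<theta>: "\<theta> \<in> lei_cells2 K" and \<eta>: "\<eta> \<in> lei_cells2 K" and \<kappa>: "\<kappa> \<in> lei_cells2 K"
    and [simp]: "tdom \<eta> = tcod \<theta>" "tdom \<kappa> = tcod \<eta>"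
  shows "lei_vcomp (lei_vcomp \<kappa> \<eta>) \<theta> = lei_vcomp \<kappa> (lei_vcomp \<eta> \<theta>)"
proof -
  let ?A = "mdom (tdom \<theta>)" and ?B = "mcod (tdom \<theta>)"
  note \<theta>' = lei_cells2D[OF \<theta> refl refl]
  note [simp] = \<theta>'(4,5)
  interpret \<theta>: leibniz_2_morphism K ?A ?B "mfun (tdom \<theta>)" "mtrans (tdom \<theta>)"
    "mfun (tcod \<theta>)" "mtrans (tcod \<theta>)" "tcomp \<theta>" by (rule \<theta>')
  note \<eta>' = lei_cells2D[OF \<eta>, of ?A ?B, simplified]
  note [simp] = \<eta>'(4,5)
  interpret \<eta>: leibniz_2_morphism K ?A ?B "mfun (tcod \<theta>)" "mtrans (tcod \<theta>)"
    "mfun (tcod \<eta>)" "mtrans (tcod \<eta>)" "tcomp \<eta>" by (rule \<eta>')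
  interpret \<kappa>: leibniz_2_morphism K ?A ?B "mfun (tcod \<eta>)" "mtrans (tcod \<eta>)"
    "mfun (tcod \<kappa>)" "mtrans (tcod \<kappa>)" "tcomp \<kappa>" using lei_cells2D(1)[OF \<kappa>, of ?A ?B] by simp
  show ?thesis
    by (rule lei_cells2_eqI[of _ K]) (simp_all add: lei_vcomp_closed \<theta> \<eta> \<kappa>)
qed

lemma lei_vcomp_id:
  assumes \<theta>: "\<theta> \<in> lei_cells2 K"
  shows "lei_vcomp \<theta> (lei_id2 (tdom \<theta>)) = \<theta>" and "lei_vcomp (lei_id2 (tcod \<theta>)) \<theta> = \<theta>"
proof -
  note \<theta>' = lei_cells2D[OF \<theta> refl refl]
  note [simp] = \<theta>'(4,5)
  interpret \<theta>: leibniz_2_morphism K "mdom (tdom \<theta>)" "mcod (tdom \<theta>)" "mfun (tdom \<theta>)"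
    "mtrans (tdom \<theta>)" "mfun (tcod \<theta>)" "mtrans (tcod \<theta>)" "tcomp \<theta>" by (rule \<theta>')
  show "lei_vcomp \<theta> (lei_id2 (tdom \<theta>)) = \<theta>" "lei_vcomp (lei_id2 (tcod \<theta>)) \<theta> = \<theta>"
    by (rule lei_cells2_eqI[of _ K]; simp add: lei_vcomp_closed lei_id2_closed \<theta> \<theta>'(2,3))+
qed

lemma lei_hcomp_assoc:
  assumes \<theta>: "\<theta> \<in> lei_cells2 K" and \<eta>: "\<eta> \<in> lei_cells2 K" and \<kappa>: "\<kappa> \<in> lei_cells2 K"
    and \<theta>\<eta>: "mcod (tdom \<theta>) = mdom (tdom \<eta>)" and \<eta>\<kappa>: "mcod (tdom \<eta>) = mdom (tdom \<kappa>)"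
  shows "lei_hcomp (lei_hcomp \<kappa> \<eta>) \<theta> = lei_hcomp \<kappa> (lei_hcomp \<eta> \<theta>)"
proof -
  note \<theta>' = lei_cells2D[OF \<theta> refl \<theta>\<eta>]
  note \<eta>' = lei_cells2D[OF \<eta> refl \<eta>\<kappa>]
  note \<kappa>' = lei_cells2D[OF \<kappa> refl refl]
  note [simp] = \<theta>'(4,5) \<eta>'(4,5) \<kappa>'(4,5)
  interpret \<theta>: leibniz_2_morphism K "mdom (tdom \<theta>)" "mdom (tdom \<eta>)" "mfun (tdom \<theta>)"
    "mtrans (tdom \<theta>)" "mfun (tcod \<theta>)" "mtrans (tcod \<theta>)" "tcomp \<theta>" by (rule \<theta>')
  interpret \<eta>: leibniz_2_morphism K "mdom (tdom \<eta>)" "mdom (tdom \<kappa>)" "mfun (tdom \<eta>)"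
    "mtrans (tdom \<eta>)" "mfun (tcod \<eta>)" "mtrans (tcod \<eta>)" "tcomp \<eta>" by (rule \<eta>')
  interpret \<kappa>: leibniz_2_morphism K "mdom (tdom \<kappa>)" "mcod (tdom \<kappa>)" "mfun (tdom \<kappa>)"
    "mtrans (tdom \<kappa>)" "mfun (tcod \<kappa>)" "mtrans (tcod \<kappa>)" "tcomp \<kappa>" by (rule \<kappa>')
  show ?thesis
    by (rule lei_cells2_eqI[of _ K])
      (simp_all add: lei_hcomp_closed \<theta> \<eta> \<kappa> \<theta>\<eta> \<eta>\<kappa> lei_comp1_assoc[of _ K] \<theta>'(2,3) \<eta>'(2,3) \<kappa>'(2,3))
qed

lemma lei_hcomp_id:
  assumes \<theta>: "\<theta> \<in> lei_cells2 K"
  shows "lei_hcomp \<theta> (lei_id2 (lei_id1 (mdom (tdom \<theta>)))) = \<theta>"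
    and "lei_hcomp (lei_id2 (lei_id1 (mcod (tdom \<theta>)))) \<theta> = \<theta>"
proof -
  note \<theta>' = lei_cells2D[OF \<theta> refl refl]
  note [simp] = \<theta>'(4,5)
  interpret \<theta>: leibniz_2_morphism K "mdom (tdom \<theta>)" "mcod (tdom \<theta>)" "mfun (tdom \<theta>)"
    "mtrans (tdom \<theta>)" "mfun (tcod \<theta>)" "mtrans (tcod \<theta>)" "tcomp \<theta>" by (rule \<theta>')
  note ids = lei_comp1_id_right[OF \<theta>'(2)] lei_comp1_id_left[OF \<theta>'(2)]
    lei_comp1_id_right[OF \<theta>'(3), simplified] lei_comp1_id_left[OF \<theta>'(3), simplified]
    lei_id1_closed[OF \<theta>.F.L.leibniz_2_algebra_axioms] lei_id1_closed[OF \<theta>.F.L'.leibniz_2_algebra_axioms]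
  show "lei_hcomp \<theta> (lei_id2 (lei_id1 (mdom (tdom \<theta>)))) = \<theta>"
    "lei_hcomp (lei_id2 (lei_id1 (mcod (tdom \<theta>)))) \<theta> = \<theta>"
    by (rule lei_cells2_eqI[of _ K]; simp add: lei_hcomp_closed lei_id2_closed \<theta> ids)+
qed

lemma lei_hcomp_id2:
  assumes F: "F \<in> lei_cells1 K" and G: "G \<in> lei_cells1 K" and FG: "mcod F = mdom G"
  shows "lei_hcomp (lei_id2 G) (lei_id2 F) = lei_id2 (lei_comp1 G F)"
proof -
  interpret F: leibniz_morphism K "mdom F" "mdom G" "mfun F" "mtrans F"
    by (rule lei_cells1D[OF F refl FG])
  interpret G: leibniz_morphism K "mdom G" "mcod G" "mfun G" "mtrans G"
    by (rule lei_cells1D[OF G refl refl])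
  show ?thesis
    by (rule lei_cells2_eqI[of _ K])
      (simp_all add: lei_hcomp_closed lei_id2_closed lei_comp1_closed assms)
qed

text \<open>The middle factors \<open>\<beta> \<bullet> F \<alpha>'\<close> and \<open>G \<alpha>' \<bullet> \<beta>\<close> of the two composites are the two sides of the naturality
  square of \<open>\<beta>\<close> at a component of \<open>\<alpha>'\<close>; \<open>F\<close> and \<open>G\<close> are the source and target of \<open>\<beta>\<close>.\<close>

lemma lei_interchange:
  assumes \<alpha>: "\<alpha> \<in> lei_cells2 K" and \<alpha>': "\<alpha>' \<in> lei_cells2 K"
    and \<beta>: "\<beta> \<in> lei_cells2 K" and \<beta>': "\<beta>' \<in> lei_cells2 K"
    and [simp]: "tdom \<alpha>' = tcod \<alpha>" "tdom \<beta>' = tcod \<beta>" and \<alpha>\<beta>: "mcod (tdom \<alpha>) = mdom (tdom \<beta>)"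
  shows "lei_hcomp (lei_vcomp \<beta>' \<beta>) (lei_vcomp \<alpha>' \<alpha>) = lei_vcomp (lei_hcomp \<beta>' \<alpha>') (lei_hcomp \<beta> \<alpha>)"
proof -
  let ?A = "mdom (tdom \<alpha>)" and ?B = "mdom (tdom \<beta>)" and ?C = "mcod (tdom \<beta>)"
  note \<alpha>1 = lei_cells2D[OF \<alpha> refl \<alpha>\<beta>]
  note \<beta>1 = lei_cells2D[OF \<beta> refl refl]
  note [simp] = \<alpha>1(4,5) \<beta>1(4,5)
  note \<alpha>2 = lei_cells2D[OF \<alpha>', of ?A ?B, simplified]
  note \<beta>2 = lei_cells2D[OF \<beta>', of ?B ?C, simplified]
  note [simp] = \<alpha>2(4,5) \<beta>2(4,5)
  interpret \<alpha>: leibniz_2_morphism K ?A ?B "mfun (tdom \<alpha>)" "mtrans (tdom \<alpha>)"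
    "mfun (tcod \<alpha>)" "mtrans (tcod \<alpha>)" "tcomp \<alpha>" by (rule \<alpha>1)
  interpret \<alpha>': leibniz_2_morphism K ?A ?B "mfun (tcod \<alpha>)" "mtrans (tcod \<alpha>)"
    "mfun (tcod \<alpha>')" "mtrans (tcod \<alpha>')" "tcomp \<alpha>'" by (rule \<alpha>2)
  interpret \<beta>: leibniz_2_morphism K ?B ?C "mfun (tdom \<beta>)" "mtrans (tdom \<beta>)"
    "mfun (tcod \<beta>)" "mtrans (tcod \<beta>)" "tcomp \<beta>" by (rule \<beta>1)
  interpret \<beta>': leibniz_2_morphism K ?B ?C "mfun (tcod \<beta>)" "mtrans (tcod \<beta>)"
    "mfun (tcod \<beta>')" "mtrans (tcod \<beta>')" "tcomp \<beta>'" by (rule \<beta>2)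
  let ?F = "ar (mfun (tdom \<beta>))" and ?G = "ar (mfun (tcod \<beta>))"
  have "(tcomp \<beta>' (ob (mfun (tcod \<alpha>')) x) \<bullet>\<^bsub>?C\<^esub> tcomp \<beta> (ob (mfun (tcod \<alpha>')) x))
        \<bullet>\<^bsub>?C\<^esub> ?F (tcomp \<alpha>' x \<bullet>\<^bsub>?B\<^esub> tcomp \<alpha> x)
      = (tcomp \<beta>' (ob (mfun (tcod \<alpha>')) x) \<bullet>\<^bsub>?C\<^esub> ?G (tcomp \<alpha>' x))
        \<bullet>\<^bsub>?C\<^esub> (tcomp \<beta> (ob (mfun (tcod \<alpha>)) x) \<bullet>\<^bsub>?C\<^esub> ?F (tcomp \<alpha> x))" (is "?l = ?r")
    if [simp]: "x \<in> Obj ?A" for x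
  proof -
    have "?l = tcomp \<beta>' (ob (mfun (tcod \<alpha>')) x)
        \<bullet>\<^bsub>?C\<^esub> (tcomp \<beta> (tgt ?B (tcomp \<alpha>' x)) \<bullet>\<^bsub>?C\<^esub> ?F (tcomp \<alpha>' x)) \<bullet>\<^bsub>?C\<^esub> ?F (tcomp \<alpha> x)"
      by simp
    also have "\<dots> = tcomp \<beta>' (ob (mfun (tcod \<alpha>')) x)
        \<bullet>\<^bsub>?C\<^esub> (?G (tcomp \<alpha>' x) \<bullet>\<^bsub>?C\<^esub> tcomp \<beta> (src ?B (tcomp \<alpha>' x))) \<bullet>\<^bsub>?C\<^esub> ?F (tcomp \<alpha> x)"
      by (subst \<beta>.trans.naturality) simp_all
    finally show ?thesis by simp
  qed
  then show ?thesis
    by (intro lei_cells2_eqI[of _ K])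
      (simp_all add: lei_hcomp_closed lei_vcomp_closed \<alpha> \<alpha>' \<beta> \<beta>' \<alpha>\<beta>)
qed

lemma category_Lei2Alg: "category (Lei2Alg K)"
  by (rule category.intro)
    (auto simp: Lei2Alg_def lei_cells0_def lei_id1_closed lei_comp1_closed lei_comp1_assoc
    lei_comp1_id_right lei_comp1_id_left dest: lei_cells1D[OF _ refl refl] leibniz_morphism.axioms)

lemma category_vertical_Lei2Alg: "category (vertical_cat (Lei2Alg K))"
  by (rule category.intro)
    (auto simp: vertical_cat_def Lei2Alg_def lei_id2_closed lei_vcomp_closed lei_vcomp_assoc
    lei_vcomp_id dest: lei_cells2D(2,3)[OF _ refl refl])

lemma category_horizontal_Lei2Alg: "category (horizontal_cat (Lei2Alg K))"
  by (rule category.intro)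
    (auto simp: horizontal_cat_def Lei2Alg_def lei_cells0_def lei_id1_closed lei_id2_closed
    lei_hcomp_closed lei_hcomp_assoc lei_hcomp_id lei_cells2D(4,5)[OF _ refl refl]
    dest: lei_cells2D(2,3)[OF _ refl refl] lei_cells1D[OF _ refl refl] leibniz_morphism.axioms)

theorem proposition15:
  fixes K :: "('k, 'c) ring_scheme"
  assumes "field K" and "char_zero K"
  shows "strict_2_category
    (Lei2Alg K :: (('k, 'o, 'm) leib2, ('k, 'o, 'm) lmor, ('k, 'o, 'm) l2mor) two_cat)"
proof (intro strict_2_category.intro strict_2_category_axioms.intro
    category_Lei2Alg category_vertical_Lei2Alg category_horizontal_Lei2Alg)
  let ?C = "Lei2Alg K :: (('k, 'o, 'm) leib2, ('k, 'o, 'm) lmor, ('k, 'o, 'm) l2mor) two_cat"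
  fix \<alpha> \<alpha>' \<beta> \<beta>' :: "('k, 'o, 'm) l2mor"
  assume "\<alpha> \<in> Cell2 ?C" "\<alpha>' \<in> Cell2 ?C" "\<beta> \<in> Cell2 ?C" "\<beta>' \<in> Cell2 ?C"
    and "tgt2 ?C \<alpha> = src2 ?C \<alpha>'" "tgt2 ?C \<beta> = src2 ?C \<beta>'" "tgt ?C (tgt2 ?C \<alpha>) = src ?C (src2 ?C \<beta>)"
  then show "hcmp ?C (vcmp ?C \<beta>' \<beta>) (vcmp ?C \<alpha>' \<alpha>) = vcmp ?C (hcmp ?C \<beta>' \<alpha>') (hcmp ?C \<beta> \<alpha>)"
    using lei_interchange[of \<alpha> K \<alpha>' \<beta> \<beta>'] lei_cells2D(5)[of \<alpha> K, OF _ refl refl]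
    by (simp add: Lei2Alg_def)
qed (simp_all add: Lei2Alg_def lei_hcomp_id2 lei_cells2D(4,5)[OF _ refl refl])

end
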